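(* Let $p,n\in\mathbb{Z}_{\geq 1}$, $q\in\mathbb{Z}_{\geq 2}$, $a\in\{1,-1\}$, and suppose $p+q$ is odd. For $1\le r\le p$ put $$S_r=\sum_{j=1}^\infty \frac{(a^n)^j\,\mathbf{H}_{nj,a}^{(r)}}{j^{p+q-r}}.$$ Then $$\begin{aligned} \sum_{k=1}^\infty\frac{a^k H_{k/n}^{(p)}}{k^q}=\;&(-1)^{q}\sum_{r=1}^{p}\frac{a}{n^{q-r}}\binom{p+q-r-1}{p-r}\,S_r\\ &-(-1)^{q}\sum_{r=2}^{p}\frac{1}{n^{q-r}}\binom{p+q-r-1}{p-r}\operatorname{Li}_r(a)\operatorname{Li}_{p+q-r}(a^n)\\ &-(-1)^{q}\sum_{\ell=2}^{q-1}\frac{(-1)^{\ell}}{n^{q-\ell}}\binom{p+q-\ell-1}{q-\ell}\operatorname{Li}_\ell(a)\zeta(p+q-\ell)\\ &+\frac{(-1)^{q}}{n^{q-1}}\binom{p+q-2}{q-1}\operatorname{Li}_1(a)\bigl\{\zeta(p+q-1)-\operatorname{Li}_{p+q-1}(a^n)\bigr\}, \end{aligned}$$ where, for $a=1$, the last term is understood to be $0$ (convention $\operatorname{Li}_1(1)=0$). Here, for each $1\le r\le p$, writing $s=p+q-r$, the sum $S_r$ is given by $$\begin{aligned} S_r=\;&\frac{a}{2}\bigl(1+(-1)^s\bigr)\operatorname{Li}_s(a^n)\operatorname{Li}_r(a)+\frac{a}{2n^r}\operatorname{Li}_{p+q}(1)\\ &-(-1)^s n^s a\sum_{i=0}^{\lfloor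 s/2\rfloor}\binom{p+q-2i-1}{r-1}n^{-2i}\operatorname{Li}_{2i}(1)\operatorname{Li}_{p+q-2i}(a)\\ &+\frac{(-1)^r a}{n^r}\sum_{i=0}^{\lfloor r/2\rfloor}\binom{p+q-2i-1}{s-1}\operatorname{Li}_{2i}(1)\operatorname{Li}_{p+q-2i}(a^n)\\ &+\frac{(-1)^r a^{n+1}}{2n^r}\sum_{i=1}^{n-1}\sum_{k=1}^{r}\binom{p+q-k-1}{s-1}a^i(-1)^k\,\Theta(1,k,i,n)\,\Phi\!\left(a^n,p+q-k,\frac{n-i}{n}\right), \end{aligned}$$ with the conventions $\operatorname{Li}_0(1)=-\tfrac12$ and $\operatorname{Li}_1(1)=0$.
   Context: $\zeta(s)=\sum_{m\ge1}m^{-s}$ is the Riemann zeta function. The polylogarithm is $\operatorname{Li}_m(x)=\sum_{k\ge1}x^k/k^m$; here it is used at $x=\pm1$, so $\operatorname{Li}_m(1)=\zeta(m)$ for $m\ge2$ and $\operatorname{Li}_1(-1)=-\ln 2$, together with the conventions $\operatorname{Li}_0(1)=\zeta(0)=-\tfrac12$ and $\operatorname{Li}_1(1)=0$. Generalized harmonic numbers with real argument $x>-1$ and order $p\in\mathbb{Z}_{\ge1}$: $H_x^{(p)}=\sum_{j=1}^\infty\left(\frac{1}{j^p}-\frac{1}{(j+x)^p}\right)$; for $p>1$ this is $\zeta(p)-\sum_{j\ge1}(j+x)^{-p}$, and for $x=N$ a positive integer it is $\sum_{k=1}^N k^{-p}$. For $a=\pm1$ and $N,r\in\mathbb{Z}_{\ge1}$: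 $\mathbf{H}_{N,a}^{(r)}=\sum_{j=1}^N \frac{a^{j-1}}{j^r}$. The Lerch transcendent is $\Phi(x,s,t)=\sum_{m=0}^\infty\frac{x^m}{(m+t)^s}$. For integers $k\ge1$ and $1\le i\le n-1$: $\Theta(1,1,i,n)=\pi\cot(\pi i/n)$, and for $k\ge2$, $\Theta(1,k,i,n)=\Phi(1,k,\tfrac{i}{n})+(-1)^k\,\Phi(1,k,\tfrac{n-i}{n})$. Empty sums are $0$. *)

theory Defs
  imports "HOL-Analysis.Analysis"
begin

text \<open>Values at integers \<open>s \<ge> 2\<close> only; the series diverges for \<open>s \<le> 1\<close>.\<close>

definition zeta_val :: "nat \<Rightarrow> real" where
  "zeta_val s = (\<Sum>m. 1 / real (Suc m) ^ s)"

text \<open>Only used at \<open>x = 1\<close> and \<open>x = -1\<close>. The two exceptional values are conventions: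
  \<open>-1/2\<close> is the value of the continued Riemann zeta function at \<open>0\<close>, whereas \<open>0\<close>
  replaces the divergent series of order \<open>1\<close> at \<open>1\<close>.\<close>

definition Li :: "nat \<Rightarrow> real \<Rightarrow> real" where
  "Li m x = (if m = 0 \<and> x = 1 then - 1 / 2
             else if m = 1 \<and> x = 1 then 0
             else (\<Sum>k. x ^ Suc k / real (Suc k) ^ m))"

definition gen_harm :: "nat \<Rightarrow> real \<Rightarrow> real" where
  "gen_harm p x = (\<Sum>j. 1 / real (Suc j) ^ p - 1 / (real (Suc j) + x) ^ p)"

definition twisted_harm :: "real \<Rightarrow> nat \<Rightarrow> nat \<Rightarrow> real" where
  "twisted_harm a r N = (\<Sum>j=1..N. a ^ (j - 1) / real j ^ r)"

definition Lerch_Phi :: "real \<Rightarrow> nat \<Rightarrow> real \<Rightarrow> real" where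
  "Lerch_Phi x s t = (\<Sum>m. x ^ m / (real m + t) ^ s)"

text \<open>The function \<open>\<Theta>(1, k, i, n)\<close>, with its constant first argument suppressed. For \<open>k = 1\<close>
  the two Lerch series diverge separately.\<close>

definition Theta_one :: "nat \<Rightarrow> nat \<Rightarrow> nat \<Rightarrow> real" where
  "Theta_one k i n =
     (if k = 1 then pi * cot (pi * real i / real n)
      else Lerch_Phi 1 k (real i / real n) + (-1) ^ k * Lerch_Phi 1 k (real (n - i) / real n))"

definition Euler_S :: "nat \<Rightarrow> nat \<Rightarrow> nat \<Rightarrow> real \<Rightarrow> nat \<Rightarrow> real" where
  "Euler_S p q n a r =
     (\<Sum>j. (a ^ n) ^ Suc j * twisted_harm a r (n * Suc j) / real (Suc j) ^ (p + q - r))"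

end

theory Submission
  imports Defs
begin

text \<open>
  Write \<open>w = p + q\<close> and let \<open>h\<^sub>r(N)\<close> stand for \<open>\<Sum>m\<le>N. a ^ m / m ^ r\<close>, which is \<open>a\<close> times the
  twisted harmonic number. Both halves of the theorem arise by exchanging the order of
  summation in an absolutely convergent double series and evaluating its rows and columns
  separately; the binomial coefficients are those of the partial fraction decomposition of
  \<open>1 / (x ^ r * y ^ s)\<close> in terms of \<open>x + y\<close> (lemma \<open>partial_fractions\<close>).

  For the closed form of \<open>S\<^sub>r\<close> let \<open>s = w - r\<close>. The double series runs over \<open>m \<ge> 1\<close> and all
  nonzero multiples \<open>N\<close> of \<open>n\<close>, positive and negative, with terms
  \<open>a ^ m * (1 / (m - N) ^ r - 1 / m ^ r) / N ^ s\<close>. Subtracting \<open>1 / m ^ r\<close> makes it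
  absolutely convergent also for \<open>r = 1\<close>. When \<open>N\<close> is fixed, the sum over \<open>m\<close> is a shifted
  polylogarithm series, so it is \<open>Li r a\<close> up to an initial segment of length \<open>\<bar>N\<bar>\<close>, that is,
  up to \<open>h\<^sub>r\<close>. The segments for \<open>N\<close> and \<open>-N\<close> come with the factors \<open>(-1) ^ r\<close> and
  \<open>- ((-1) ^ s)\<close>; as \<open>r + s\<close> is odd, they reinforce each other, and the columns add up to
  \<open>S\<^sub>r\<close>, polylogarithm values and their products (lemma \<open>lattice_column_sums\<close>). For even \<open>r + s\<close>
  they would cancel; this is where the parity hypothesis enters. When \<open>m\<close> is fixed, partial
  fractions reduce the sum over \<open>N\<close> to the symmetric sums of \<open>1 / N ^ k\<close>, which are zeta values
  for even \<open>k\<close> and vanish for odd \<open>k\<close>, and of \<open>1 / (m - N) ^ k\<close>. The latter depend only on \<open>m\<close>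
  modulo \<open>n\<close> and are the numbers \<open>\<Theta>(1, k, i, n)\<close>; for \<open>k = 1\<close> this is the cotangent expansion,
  which follows from the reflection formula of the Gamma function. Summing over \<open>m\<close>
  one residue class at a time turns the powers of \<open>m\<close> into Lerch values (lemmas
  \<open>lattice_row_sums\<close> and \<open>lattice_row_total\<close>).

  For the harmonic series the double series has the terms
  \<open>a ^ k / k ^ q * (1 / j ^ p - n ^ p / (n * j + k) ^ p)\<close>. Summing over \<open>j\<close> first gives
  \<open>H\<^bsub>k/n\<^esub>\<close>. When \<open>j\<close> is fixed, partial fractions in \<open>k\<close> and \<open>n * j + k\<close>, whose difference
  is \<open>n * j\<close>, leave again shifted polylogarithm series; the initial segments \<open>h\<^sub>r(n * j)\<close>
  assemble to the sums \<open>S\<^sub>r\<close> (lemma \<open>gen_harm_series\<close>).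

  Division by zero has the value zero. The double series makes use of this: the pair
  \<open>m = N\<close> is kept, its first fraction being zero.
\<close>

section \<open>Partial fractions\<close>

lemma hockey_stick_lower:
  fixes s r :: nat
  shows "(\<Sum>k\<le>r. (r + s - k) choose s) = Suc (r + s) choose Suc s"
proof -
  have "(\<Sum>k\<le>r. (r + s - k) choose s) = (\<Sum>k\<le>r. (s + k) choose s)"
    by (rule sum.reindex_bij_witness[of _ "\<lambda>k. r - k" "\<lambda>k. r - k"]) (auto simp: add.commute)
  also have "\<dots> = Suc (s + r) choose Suc s"
    by (induction r) auto
  finally show ?thesis by (simp add: add.commute)
qed

text \<open>
  The part of the decomposition of \<open>X ^ Suc r * Y ^ Suc s\<close> that involves \<open>X\<close>, for variables
  related by \<open>X * Y = M * (X + Y)\<close>, as is the case for \<open>X = 1 / x\<close>, \<open>Y = 1 / y\<close> and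
  \<open>M = 1 / (x + y)\<close>. Working with the reciprocals keeps everything polynomial. The exponents
  are shifted by one because the boundary of the recursion is at exponent one, not zero.
\<close>

definition pfrac :: "'a::comm_ring_1 \<Rightarrow> 'a \<Rightarrow> nat \<Rightarrow> nat \<Rightarrow> 'a" where
  "pfrac X M r s = (\<Sum>k\<le>r. of_nat ((r + s - k) choose s) * X ^ Suc k * M ^ (Suc (r + s) - k))"

lemma pfrac_0: "pfrac X M 0 s = X * M ^ Suc s"
  by (simp add: pfrac_def)

lemma pfrac_Suc_0: "pfrac X M (Suc r) 0 = M * pfrac X M r 0 + M * X ^ Suc (Suc r)"
  by (simp add: pfrac_def sum_distrib_left Suc_diff_le mult_ac)

text \<open>
  Pascal's rule for the coefficients. It matches the identity
  \<open>X * Y * Z = M * (X * Z + Y * Z)\<close>, which lowers one of the two exponents in each summand.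
\<close>

lemma pfrac_Suc_Suc:
  "pfrac X M (Suc r) (Suc s) = M * (pfrac X M r (Suc s) + pfrac X M (Suc r) s)"
proof -
  have "pfrac X M (Suc r) (Suc s) = (\<Sum>k\<le>r. of_nat ((Suc r + Suc s - k) choose Suc s) * X ^ Suc k * M ^ (Suc (Suc r + Suc s) - k))
      + X ^ Suc (Suc r) * M ^ (Suc (Suc s))"
    by (simp add: pfrac_def)
  also have "(\<Sum>k\<le>r. of_nat ((Suc r + Suc s - k) choose Suc s) * X ^ Suc k * M ^ (Suc (Suc r + Suc s) - k))
     = M * ((\<Sum>k\<le>r. of_nat ((r + Suc s - k) choose Suc s) * X ^ Suc k * M ^ (Suc (r + Suc s) - k))
       + (\<Sum>k\<le>r. of_nat ((Suc r + s - k) choose s) * X ^ Suc k * M ^ (Suc (Suc r + s) - k)))"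
    unfolding sum.distrib[symmetric] sum_distrib_left
  proof (intro sum.cong refl)
    fix k assume "k \<in> {..r}"
    then obtain d where d: "r = k + d" using le_Suc_ex by auto
    show "of_nat ((Suc r + Suc s - k) choose Suc s) * X ^ Suc k * M ^ (Suc (Suc r + Suc s) - k)
     = M * (of_nat ((r + Suc s - k) choose Suc s) * X ^ Suc k * M ^ (Suc (r + Suc s) - k)
       + of_nat ((Suc r + s - k) choose s) * X ^ Suc k * M ^ (Suc (Suc r + s) - k))"
      by (simp add: d power_add power3_eq_cube algebra_simps)
  qed
  also have "M * ((\<Sum>k\<le>r. of_nat ((r + Suc s - k) choose Suc s) * X ^ Suc k * M ^ (Suc (r + Suc s) - k))
       + (\<Sum>k\<le>r. of_nat ((Suc r + s - k) choose s) * X ^ Suc k * M ^ (Suc (Suc r + s) - k)))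
       + X ^ Suc (Suc r) * M ^ (Suc (Suc s)) = M * (pfrac X M r (Suc s) + pfrac X M (Suc r) s)"
    by (simp add: pfrac_def algebra_simps)
  finally show ?thesis .
qed

lemma power_mult_power_eq_pfrac:
  fixes X Y M :: "'a::comm_ring_1"
  assumes XY: "X * Y = M * (X + Y)"
  shows "X ^ Suc r * Y ^ Suc s = pfrac X M r s + pfrac Y M s r"
proof -
  have edge: "X * Y ^ Suc s = pfrac X M 0 s + pfrac Y M s 0"
    if "X * Y = M * (X + Y)" for X Y :: 'a and s
  proof (induction s)
    case 0
    show ?case using that by (simp add: pfrac_0 algebra_simps)
  next
    case (Suc s)
    have "X * Y ^ Suc (Suc s) = (X * Y) * Y ^ Suc s" by (simp add: mult_ac)
    also have "\<dots> = M * (X * Y ^ Suc s) + M * Y ^ Suc (Suc s)"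
      by (simp only: that) (simp add: algebra_simps)
    finally show ?case using Suc by (simp add: pfrac_0 pfrac_Suc_0 algebra_simps)
  qed
  show ?thesis
  proof (induction r arbitrary: s)
    case 0
    show ?case using edge[OF XY] by simp
  next
    case (Suc r)
    note IHr = Suc.IH
    show ?case
    proof (induction s)
      case 0
      show ?case using edge[of Y X "Suc r"] XY by (simp add: mult.commute add.commute)
    next
      case (Suc s)
      have "X ^ Suc (Suc r) * Y ^ Suc (Suc s) = (X * Y) * (X ^ Suc r * Y ^ Suc s)"
        by (simp add: mult_ac)
      also have "\<dots> = M * (X ^ Suc (Suc r) * Y ^ Suc s) + M * (X ^ Suc r * Y ^ Suc (Suc s))"
        by (simp only: XY) (simp add: algebra_simps)
      also have "\<dots> = pfrac X M (Suc r) (Suc s) + pfrac Y M (Suc s) (Suc r)"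
        unfolding IHr Suc.IH pfrac_Suc_Suc by (simp add: algebra_simps)
      finally show ?case .
    qed
  qed
qed

lemma pfrac_eq_sum:
  assumes "r \<ge> 1" "s \<ge> 1"
  shows "pfrac X M (r - 1) (s - 1) =
    (\<Sum>k=1..r. of_nat ((r + s - k - 1) choose (s - 1)) * M ^ (r + s - k) * X ^ k)"
proof -
  obtain r' s' where rs: "r = Suc r'" "s = Suc s'" using assms by (metis Suc_le_D One_nat_def)
  show ?thesis unfolding pfrac_def rs
    by (rule sum.reindex_bij_witness[of _ "\<lambda>k. k - 1" Suc]) (auto simp: mult_ac)
qed

lemma partial_fractions:
  fixes X Y M :: "'a::comm_ring_1"
  assumes XY: "X * Y = M * (X + Y)" and rs: "r \<ge> 1" "s \<ge> 1"
  shows "X ^ r * Y ^ s =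
      (\<Sum>k=1..r. of_nat ((r + s - k - 1) choose (s - 1)) * M ^ (r + s - k) * X ^ k)
    + (\<Sum>k=1..s. of_nat ((r + s - k - 1) choose (r - 1)) * M ^ (r + s - k) * Y ^ k)"
  using power_mult_power_eq_pfrac[OF XY, of "r - 1" "s - 1"] pfrac_eq_sum[OF rs, of X M]
    pfrac_eq_sum[OF rs(2,1), of Y M] rs by (simp add: add.commute)

lemma sum_partial_fraction_coeffs:
  assumes "r \<ge> 1" "s \<ge> 1"
  shows "(\<Sum>k=1..r. (r + s - k - 1) choose (s - 1)) = (r + s - 1) choose s"
proof -
  obtain r' s' where rs: "r = Suc r'" "s = Suc s'" using assms by (metis Suc_le_D One_nat_def)
  have "(\<Sum>k=1..r. (r + s - k - 1) choose (s - 1)) = (\<Sum>k\<le>r'. (r' + s' - k) choose s')"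
    unfolding rs by (rule sum.reindex_bij_witness[of _ Suc "\<lambda>k. k - 1"]) auto
  then show ?thesis by (simp add: hockey_stick_lower rs)
qed

section \<open>Absolutely convergent double series\<close>

text \<open>
  Absolute convergence concerns unordered sums, but where an unordered sum exists it agrees with
  the limit of the partial sums; therefore the values of rows and columns may be computed from
  partial sums in the natural order of the indices.
\<close>

lemma double_series_exchange:
  fixes f :: "nat \<Rightarrow> nat \<Rightarrow> real"
  assumes f: "(\<lambda>(i, j). f i j) summable_on UNIV"
    and R: "\<And>i. (\<lambda>j. f i j) sums R i" and C: "\<And>j. (\<lambda>i. f i j) sums C j"
  obtains S where "R sums S" "C sums S"
proof -
  obtain S where S: "((\<lambda>(i, j). f i j) has_sum S) (UNIV \<times> UNIV)"
    using f by (auto simp: summable_on_def)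
  have R': "((\<lambda>j. f i j) has_sum R i) UNIV" for i
  proof -
    have "(\<lambda>j. f i j) summable_on UNIV"
      using summable_on_SigmaD1[of f UNIV "\<lambda>_. UNIV" i] f by simp
    then obtain x where x: "((\<lambda>j. f i j) has_sum x) UNIV" by (auto simp: summable_on_def)
    with R[of i] has_sum_imp_sums sums_unique2 show ?thesis by metis
  qed
  have S': "((\<lambda>(j, i). f i j) has_sum S) (UNIV \<times> UNIV)"
    using S by (subst has_sum_swap) simp
  have C': "((\<lambda>i. f i j) has_sum C j) UNIV" for j
  proof -
    have "(\<lambda>i. f i j) summable_on UNIV"
      using summable_on_SigmaD1[of "\<lambda>j i. f i j" UNIV "\<lambda>_. UNIV" j] S' by (auto simp: summable_on_def)
    then obtain x where x: "((\<lambda>i. f i j) has_sum x) UNIV" by (auto simp: summable_on_def)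
    with C[of j] has_sum_imp_sums sums_unique2 show ?thesis by metis
  qed
  have "R sums S" using has_sum_Sigma'[OF S, of R] R' has_sum_imp_sums by simp
  moreover have "C sums S" using has_sum_Sigma'[OF S', of C] C' has_sum_imp_sums by simp
  ultimately show ?thesis using that by blast
qed

text \<open>
  By \<open>x + y \<ge> sqrt (x * y)\<close> the kernel is dominated by the product of \<open>x powr (-3/2)\<close> and
  \<open>y powr (-3/2)\<close>.
\<close>

lemma summable_on_cubic_kernel:
  "(\<lambda>(x, y). 1 / (real x * real y * real (x + y))) summable_on UNIV"
proof -
  define g where "g x = (real x) powr (-3/2)" for x :: nat
  have g: "g summable_on UNIV"
    unfolding g_def by (subst summable_on_UNIV_nonneg_real_iff) (simp_all only: summable_real_powr_iff, simp_all)
  have "(\<lambda>(x, y). g x * g y) summable_on Sigma UNIV (\<lambda>_. UNIV)"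
  proof (rule summable_on_SigmaI)
    fix x show "((\<lambda>y. case (x, y) of (x, y) \<Rightarrow> g x * g y) has_sum (g x * infsum g UNIV)) UNIV"
      using g by (simp add: has_sum_cmult_right)
  next
    show "(\<lambda>x. g x * infsum g UNIV) summable_on UNIV"
      by (intro summable_on_cmult_left g)
  qed (auto simp: g_def)
  then have gg: "(\<lambda>(x, y). g x * g y) summable_on UNIV" by simp
  show ?thesis
  proof (rule summable_on_comparison_test[OF gg])
    fix z :: "nat \<times> nat"
    obtain x y where z: "z = (x, y)" by (cases z)
    show "(case z of (x, y) \<Rightarrow> 1 / (real x * real y * real (x + y))) \<le> (case z of (x, y) \<Rightarrow> g x * g y)"
    proof (cases "x = 0 \<or> y = 0")
      case True then show ?thesis by (auto simp: z g_def)
    next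
      case False
      then have pos: "real x > 0" "real y > 0" by auto
      have gx: "g t = 1 / (real t * sqrt (real t))" if "real t > 0" for t
      proof -
        have "g t = 1 / real t powr (1 + 1/2)" by (simp add: g_def powr_minus_divide)
        also have "\<dots> = 1 / (real t * sqrt (real t))" using that
          by (subst powr_add) (simp add: powr_half_sqrt)
        finally show ?thesis .
      qed
      have "sqrt (real x * real y) \<le> real x + real y"
        by (rule real_le_lsqrt) (use pos in \<open>auto simp: power2_eq_square algebra_simps\<close>)
      then have "real x * real y * sqrt (real x * real y) \<le> real x * real y * real (x + y)"
        using pos by (intro mult_left_mono) auto
      then have "1 / (real x * real y * real (x + y)) \<le> 1 / (real x * real y * sqrt (real x * real y))"
        using pos by (intro divide_left_mono) auto
      also have "\<dots> = g x * g y" using pos by (simp add: gx real_sqrt_mult)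
      finally show ?thesis by (simp add: z)
    qed
  qed auto
qed

text \<open>
  Off the diagonal the largest of \<open>x\<close>, \<open>y\<close> and \<open>\<bar>x - y\<bar>\<close> is the sum of the other two, so each of
  the regions \<open>y < x\<close> and \<open>x < y\<close> carries a copy of the previous kernel. The diagonal value is
  the one that dominates the pair \<open>m = N\<close> of the lattice series below.
\<close>

lemma summable_on_lattice_kernel:
  "(\<lambda>(x, y). if x = y then 1 / real x ^ 3 else 1 / (real x * real y * \<bar>real x - real y\<bar>)) summable_on UNIV"
  (is "?K summable_on _")
proof -
  have A: "?K summable_on (\<lambda>(x, y). (x + y, y)) ` UNIV" (is "_ summable_on ?A ` _")
  proof (subst summable_on_reindex)
    show "inj ?A" by (auto simp: inj_on_def)
    define g where "g = (\<lambda>(x::nat, y::nat). if x = 0 then 1 / real y ^ 3 else 0)"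
    have "g summable_on (Pair 0) ` UNIV"
      by (subst summable_on_reindex)
        (auto simp: o_def g_def inj_on_def summable_on_UNIV_nonneg_real_iff
          inverse_power_summable[of 3, where ?'a = real] field_simps
          intro!: inverse_power_summable[of 3, where ?'a = real, simplified inverse_eq_divide])
    then have "g summable_on UNIV"
      by (rule summable_on_cong_neutral[THEN iffD1, rotated -1]) (auto simp: g_def split: if_splits)
    from summable_on_add[OF summable_on_cubic_kernel this]
    show "(?K \<circ> ?A) summable_on UNIV"
      by (rule summable_on_cong[THEN iffD1, rotated]) (auto simp: g_def)
  qed
  have B: "?K summable_on (\<lambda>(x, y). (y, x + y)) ` UNIV" (is "_ summable_on ?B ` _")
  proof (subst summable_on_reindex)
    show "inj ?B" by (auto simp: inj_on_def)
    have "(?K \<circ> ?A) summable_on UNIV"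
      using A by (subst (asm) summable_on_reindex) (auto simp: inj_on_def)
    then show "(?K \<circ> ?B) summable_on UNIV"
      by (rule summable_on_cong[THEN iffD1, rotated]) auto
  qed
  have "range ?A \<union> range ?B = UNIV"
  proof (intro equalityI subset_UNIV subsetI)
    fix z :: "nat \<times> nat"
    obtain x y where z: "z = (x, y)" by (cases z)
    show "z \<in> range ?A \<union> range ?B"
    proof (cases "y \<le> x")
      case True
      then have "z = ?A (x - y, y)" by (simp add: z)
      then have "z \<in> range ?A" by (rule range_eqI)
      then show ?thesis ..
    next
      case False
      then have "z = ?B (y - x, x)" by (simp add: z)
      then have "z \<in> range ?B" by (rule range_eqI)
      then show ?thesis ..
    qed
  qed
  with summable_on_union[OF A B] show ?thesis by (simp only:)
qed

text \<open>
  This bound reduces all exponents to the case of exponent one: the gain of a factor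
  \<open>\<bar>x - y\<bar> / (\<bar>x\<bar> * \<bar>y\<bar>)\<close> is what brings the double series under the kernels above.
\<close>

lemma abs_inverse_power_diff_le:
  fixes x y :: real
  assumes "\<bar>x\<bar> \<ge> 1" "\<bar>y\<bar> \<ge> 1"
  shows "\<bar>1 / x ^ r - 1 / y ^ r\<bar> \<le> real r * (\<bar>x - y\<bar> / (\<bar>x\<bar> * \<bar>y\<bar>))"
proof -
  have "norm ((1 / x) ^ r - (1 / y) ^ r) \<le> real r * norm (1 / x - 1 / y)"
    using assms by (intro norm_power_diff) (auto simp: divide_simps)
  moreover have "norm (1 / x - 1 / y) = \<bar>x - y\<bar> / (\<bar>x\<bar> * \<bar>y\<bar>)"
  proof -
    have "1 / x - 1 / y = (y - x) / (x * y)" using assms by (auto simp: field_simps)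
    then show ?thesis by (simp add: abs_mult abs_minus_commute)
  qed
  ultimately show ?thesis by (simp add: power_one_over)
qed

section \<open>Shifted polylogarithm series\<close>

definition Li_part :: "real \<Rightarrow> nat \<Rightarrow> nat \<Rightarrow> real" where
  "Li_part a r N = (\<Sum>i<N. a ^ Suc i / real (Suc i) ^ r)"

lemma sign_power_simps:
  fixes a :: real
  assumes "a \<in> {1, -1}"
  shows "a ^ N * a ^ N = 1" "a ^ N * (a ^ N * c) = c" "\<bar>a ^ N\<bar> = 1"
  using assms by (auto simp: power_mult_distrib[symmetric] mult.assoc[symmetric] power_abs)

lemma Li_part_eq_twisted_harm:
  assumes "a \<in> {1, -1}"
  shows "Li_part a r N = a * twisted_harm a r N"
proof -
  have "twisted_harm a r N = (\<Sum>i<N. a ^ i / real (Suc i) ^ r)"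
    unfolding twisted_harm_def by (rule sum.reindex_bij_witness[of _ Suc "\<lambda>j. j - 1"]) auto
  then show ?thesis by (simp add: Li_part_def sum_distrib_left)
qed

text \<open>
  For \<open>r = 1\<close> only the alternating series is left, and Leibniz' criterion applies; otherwise
  the convergence is absolute.
\<close>

lemma Li_sums:
  assumes a: "a \<in> {1, -1}" and r: "r \<ge> 1" and ne: "r \<noteq> 1 \<or> a \<noteq> 1"
  shows "(\<lambda>i. a ^ Suc i / real (Suc i) ^ r) sums Li r a"
proof -
  have "summable (\<lambda>i. a ^ Suc i / real (Suc i) ^ r)"
  proof (cases "r = 1")
    case True
    then have "a = -1" using a ne by auto
    have "summable (\<lambda>i. (-1) ^ i * (1 / real (Suc i)))"
      by (rule summable_Leibniz'(1)[OF LIMSEQ_Suc[OF lim_1_over_n]]) (auto simp: field_simps)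
    from summable_minus[OF this] show ?thesis using True \<open>a = -1\<close> by simp
  next
    case False
    then have r2: "r \<ge> 2" using r by simp
    have "summable (\<lambda>i. norm (a ^ Suc i / real (Suc i) ^ r))"
      using a inverse_power_summable[OF r2, where ?'a = real]
      by (subst (asm) summable_Suc_iff[symmetric]) (auto simp: power_abs field_simps)
    then show ?thesis by (rule summable_norm_cancel)
  qed
  moreover have "Li r a = (\<Sum>i. a ^ Suc i / real (Suc i) ^ r)"
    using r ne by (auto simp: Li_def)
  ultimately show ?thesis by (simp add: summable_sums)
qed

lemma Li_one_sums: "s \<ge> 2 \<Longrightarrow> (\<lambda>i. 1 / real (Suc i) ^ s) sums Li s 1"
  using Li_sums[of 1 s] by simp

lemma zeta_val_eq_Li: "s \<ge> 2 \<Longrightarrow> zeta_val s = Li s 1"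
  using Li_one_sums[of s] by (simp add: zeta_val_def sums_iff)

text \<open>
  Since \<open>a ^ i = a ^ M * a ^ (i + M)\<close>, the shifted series is \<open>a ^ M\<close> times the tail after \<open>M\<close>
  terms. For \<open>r = 1\<close> and \<open>a = 1\<close> both series diverge, but their partial sums of lengths \<open>K + M\<close>
  and \<open>K\<close> differ by \<open>M\<close> terms that tend to zero, and the convention \<open>Li 1 1 = 0\<close> makes the same formula
  hold.
\<close>

lemma shifted_difference_sums:
  assumes a: "a \<in> {1, -1}" and r: "r \<ge> 1"
  shows "(\<lambda>i. a ^ Suc i * (1 / (real (Suc i) + real M) ^ r - 1 / real (Suc i) ^ r))
           sums (a ^ M * (Li r a - Li_part a r M) - Li r a)"
proof -
  have part: "(\<Sum>i<K. a ^ Suc i * (1 / (real (Suc i) + real M) ^ r - 1 / real (Suc i) ^ r))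
      = a ^ M * (Li_part a r (K + M) - Li_part a r M) - Li_part a r K" for K
  proof (induction K)
    case (Suc K)
    have "a ^ Suc K = a ^ M * a ^ Suc (K + M)"
      using sign_power_simps(2)[OF a, of M "a ^ Suc K"] by (simp add: power_add mult_ac)
    then show ?case using Suc by (simp add: Li_part_def algebra_simps diff_divide_distrib)
  qed (simp add: Li_part_def)
  have "(\<lambda>K. a ^ M * (Li_part a r (K + M) - Li_part a r M) - Li_part a r K)
          \<longlonglongrightarrow> a ^ M * (Li r a - Li_part a r M) - Li r a"
  proof (cases "r = 1 \<and> a = 1")
    case False
    then have "Li_part a r \<longlonglongrightarrow> Li r a"
      using Li_sums[OF a r] unfolding sums_def Li_part_def[abs_def] by blast
    then show ?thesis by (intro tendsto_intros LIMSEQ_ignore_initial_segment)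
  next
    case True
    have "(\<lambda>K. Li_part a r (K + M) - Li_part a r K) \<longlonglongrightarrow> 0"
    proof (induction M)
      case (Suc M)
      have "(\<lambda>K. 1 / real (Suc (K + M))) \<longlonglongrightarrow> 0"
        using LIMSEQ_ignore_initial_segment[OF lim_1_over_n, of "Suc M"] by simp
      from tendsto_add[OF Suc this] show ?case
        using True by (simp add: Li_part_def algebra_simps)
    qed simp
    from tendsto_diff[OF this tendsto_const, of "Li_part a r M"] show ?thesis
      using True by (simp add: Li_def algebra_simps)
  qed
  then show ?thesis by (simp only: sums_def part)
qed

text \<open>
  The terms with \<open>m > N\<close> form, up to sign, a series as in the previous lemma; those with
  \<open>m < N\<close> are an initial segment read backwards. At \<open>m = N\<close> the reciprocal is zero, hence the
  correction \<open>(-1) ^ r / N ^ r\<close>, which removes the last term from \<open>Li_part a r N\<close>.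
\<close>

lemma reflected_difference_sums:
  assumes a: "a \<in> {1, -1}" and r: "r \<ge> 1" and N: "N \<ge> 1"
  shows "(\<lambda>i. a ^ Suc i * (1 / (real (Suc i) - real N) ^ r - 1 / real (Suc i) ^ r))
     sums ((a ^ N - 1) * Li r a + (-1) ^ r * a ^ N * Li_part a r N - (-1) ^ r / real N ^ r)"
    (is "?f sums ?S")
proof -
  have "(\<lambda>i. - (a ^ N) * (a ^ Suc i * (1 / (real (Suc i) + real N) ^ r - 1 / real (Suc i) ^ r)))
          sums (- (a ^ N) * (a ^ N * (Li r a - Li_part a r N) - Li r a))"
    by (intro sums_mult shifted_difference_sums a r)
  moreover have "- (a ^ N) * (a ^ Suc i * (1 / (real (Suc i) + real N) ^ r - 1 / real (Suc i) ^ r))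
      = ?f (i + N)" for i
    by (simp add: power_add algebra_simps)
  moreover have "- (a ^ N) * (a ^ N * (Li r a - Li_part a r N) - Li r a) = a ^ N * Li r a - Li r a + Li_part a r N"
    using sign_power_simps(2)[OF a, of N "Li r a - Li_part a r N"] by (simp only: right_diff_distrib)
  ultimately have tail: "(\<lambda>i. ?f (i + N)) sums (a ^ N * Li r a - Li r a + Li_part a r N)"
    by simp
  obtain N' where N': "N = Suc N'" using N by (cases N) auto
  \<comment> \<open>Substitute \<open>i\<close> for \<open>N - m\<close>; the value \<open>i = 0\<close>, coming from \<open>m = N\<close>, contributes zero.\<close>
  have "(\<Sum>i<N. a ^ Suc i * (1 / (real (Suc i) - real N) ^ r))
      = (\<Sum>i<N. (-1) ^ r * (a ^ N * (a ^ i / real i ^ r)))"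
  proof (rule sum.reindex_bij_witness[of _ "\<lambda>i. N - Suc i" "\<lambda>i. N - Suc i"])
    fix i assume i: "i \<in> {..<N}"
    then obtain d where d: "N = Suc (i + d)" by (auto simp: less_iff_Suc_add)
    have "(-1) ^ r * (a ^ N * (a ^ (N - Suc i) / real (N - Suc i) ^ r))
        = (a ^ d * a ^ d) * (a ^ Suc i * ((-1) ^ r / real d ^ r))"
      by (simp add: d power_add mult_ac)
    also have "\<dots> = a ^ Suc i * (1 / (- real d) ^ r)"
      unfolding sign_power_simps(1)[OF a] by (cases "even r") auto
    also have "- real d = real (Suc i) - real N" by (simp add: d)
    finally show "(-1) ^ r * (a ^ N * (a ^ (N - Suc i) / real (N - Suc i) ^ r))
      = a ^ Suc i * (1 / (real (Suc i) - real N) ^ r)" .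
  qed auto
  also have "\<dots> = (-1) ^ r * (a ^ N * (\<Sum>i<N. a ^ i / real i ^ r))"
    by (simp add: sum_distrib_left)
  also have "(\<Sum>i<N. a ^ i / real i ^ r) = Li_part a r N - a ^ N / real N ^ r"
    unfolding N' sum.lessThan_Suc_shift[of "\<lambda>i. a ^ i / real i ^ r"]
    using r by (simp add: Li_part_def power_0_left)
  also have "(-1) ^ r * (a ^ N * (Li_part a r N - a ^ N / real N ^ r))
     = (-1) ^ r * a ^ N * Li_part a r N - (-1) ^ r / real N ^ r"
    using sign_power_simps(1)[OF a, of N] by (simp add: algebra_simps)
  finally have "(\<Sum>i<N. ?f i) = (-1) ^ r * a ^ N * Li_part a r N - (-1) ^ r / real N ^ r - Li_part a r N"
    by (simp add: right_diff_distrib sum_subtractf Li_part_def)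
  moreover have "?f sums (a ^ N * Li r a - Li r a + Li_part a r N + (\<Sum>i<N. ?f i))"
    by (rule sums_iff_shift[of ?f N, THEN iffD1, OF tail])
  moreover have "a ^ N * Li r a - Li r a + Li_part a r N
      + ((-1) ^ r * a ^ N * Li_part a r N - (-1) ^ r / real N ^ r - Li_part a r N) = ?S"
    by (simp add: left_diff_distrib)
  ultimately show ?thesis by (simp only:)
qed

section \<open>Symmetric sums over the integers\<close>

lemma Lerch_Phi_sums:
  assumes x: "\<bar>x\<bar> \<le> 1" and t: "t > 0" and s: "s \<ge> 2"
  shows "(\<lambda>m. x ^ m / (real m + t) ^ s) sums Lerch_Phi x s t"
proof -
  have "summable (\<lambda>m. x ^ Suc m / (real (Suc m) + t) ^ s)"
  proof (rule summable_comparison_test'[where N = 0])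
    show "summable (\<lambda>m. 1 / real (Suc m) ^ s)" using Li_one_sums[OF s] by (rule sums_summable)
    fix m
    have "\<bar>x ^ Suc m\<bar> \<le> 1" using x by (simp add: power_abs power_le_one del: power_Suc)
    moreover have "real (Suc m) ^ s \<le> (real (Suc m) + t) ^ s"
      using t by (intro power_mono) auto
    ultimately show "norm (x ^ Suc m / (real (Suc m) + t) ^ s) \<le> 1 / real (Suc m) ^ s"
      using t by (simp add: abs_mult frac_le del: power_Suc)
  qed
  then have "summable (\<lambda>m. x ^ m / (real m + t) ^ s)" by (subst (asm) summable_Suc_iff)
  then show ?thesis by (simp add: Lerch_Phi_def summable_sums)
qed

text \<open>
  The logarithmic derivative of the reflection formula
  \<open>rGamma t * rGamma (1 - t) = sin (pi * t) / pi\<close>.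
\<close>

lemma Digamma_reflection:
  fixes t :: real
  assumes "0 < t" "t < 1"
  shows "Digamma (1 - t) - Digamma t = pi * cot (pi * t)"
proof -
  have refl: "rGamma t * rGamma (1 - t) = sin (pi * t) / pi" for t :: real
  proof -
    have "complex_of_real (rGamma t * rGamma (1 - t)) = rGamma (of_real t) * rGamma (1 - of_real t)"
      by (simp add: rGamma_complex_of_real[symmetric])
    also have "\<dots> = complex_of_real (sin (pi * t) / pi)"
      by (simp add: rGamma_reflection_complex sin_of_real flip: of_real_mult)
    finally show ?thesis by (simp only: of_real_eq_iff)
  qed
  have nn: "t \<notin> \<int>\<^sub>\<le>\<^sub>0" "1 - t \<notin> \<int>\<^sub>\<le>\<^sub>0" using assms by (auto elim!: nonpos_Ints_cases)
  have "((\<lambda>t. rGamma t * rGamma (1 - t)) has_field_derivative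
      (rGamma t * rGamma (1 - t) * (Digamma (1 - t) - Digamma t))) (at t)"
    using nn by (auto intro!: derivative_eq_intros simp: algebra_simps)
  moreover have "((\<lambda>t. sin (pi * t) / pi) has_field_derivative cos (pi * t)) (at t)"
    by (auto intro!: derivative_eq_intros)
  ultimately have "sin (pi * t) / pi * (Digamma (1 - t) - Digamma t) = cos (pi * t)"
    unfolding refl using DERIV_unique by blast
  moreover have "sin (pi * t) > 0" using assms by (intro sin_gt_zero) auto
  ultimately show ?thesis by (simp add: cot_def field_simps)
qed

text \<open>
  The symmetric limit of the sums of \<open>1 / (x - j) ^ k\<close> over the integers \<open>j\<close> with \<open>\<bar>j\<bar> \<le> J\<close> is \<open>A\<close>.
  The term \<open>j = 0\<close> appears on the right-hand side. If \<open>x\<close> is an integer, then the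
  term with vanishing denominator is zero.
\<close>

definition has_lattice_sum :: "nat \<Rightarrow> real \<Rightarrow> real \<Rightarrow> bool" where
  "has_lattice_sum k x A \<longleftrightarrow>
     (\<lambda>j. 1 / (x - real (Suc j)) ^ k + 1 / (x + real (Suc j)) ^ k) sums (A - 1 / x ^ k)"

text \<open>
  Replacing \<open>x\<close> by \<open>x + 1\<close> moves the window of summation by one, which changes the partial sums
  by two boundary terms that tend to zero.
\<close>

lemma has_lattice_sum_shift:
  assumes k: "k \<ge> 1" and x: "has_lattice_sum k x A"
  shows "has_lattice_sum k (x + 1) A"
proof -
  define S where "S = (\<lambda>x J. 1 / x ^ k + (\<Sum>j<J. 1 / (x - real (Suc j)) ^ k + 1 / (x + real (Suc j)) ^ k))"
  have S_iff: "has_lattice_sum k x A \<longleftrightarrow> S x \<longlonglongrightarrow> A" for x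
  proof -
    have "has_lattice_sum k x A \<longleftrightarrow> (\<lambda>J. S x J - 1 / x ^ k) \<longlonglongrightarrow> A - 1 / x ^ k"
      by (simp add: has_lattice_sum_def sums_def S_def)
    also have "\<dots> \<longleftrightarrow> S x \<longlonglongrightarrow> A"
      using tendsto_diff[of "S x" A sequentially "\<lambda>_. 1 / x ^ k" "1 / x ^ k"]
        tendsto_add[of "\<lambda>J. S x J - 1 / x ^ k" "A - 1 / x ^ k" sequentially "\<lambda>_. 1 / x ^ k" "1 / x ^ k"]
      by auto
    finally show ?thesis .
  qed
  have step: "S (x + 1) J = S x J + (1 / (x + 1 + real J)) ^ k - (1 / (x - real J)) ^ k" for J
    by (induction J) (simp_all add: S_def power_one_over algebra_simps)
  have "(\<lambda>J. 1 / (x + 1 + real J)) \<longlonglongrightarrow> 0"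
    by (rule real_tendsto_divide_at_top[OF tendsto_const]
         filterlim_tendsto_add_at_top[OF tendsto_const] filterlim_real_sequentially)+
  moreover have "(\<lambda>J. 1 / (x - real J)) \<longlonglongrightarrow> 0"
  proof -
    have "(\<lambda>J. - (1 / (- x + real J))) \<longlonglongrightarrow> - 0"
      by (rule tendsto_minus real_tendsto_divide_at_top[OF tendsto_const]
         filterlim_tendsto_add_at_top[OF tendsto_const] filterlim_real_sequentially)+
    moreover have "- (1 / (- x + real J)) = 1 / (x - real J)" for J
      by (metis add_uminus_conv_diff add.commute minus_diff_eq minus_divide_right)
    ultimately show ?thesis by simp
  qed
  ultimately have "(\<lambda>J. S x J + (1 / (x + 1 + real J)) ^ k - (1 / (x - real J)) ^ k) \<longlonglongrightarrow> A + 0 ^ k - 0 ^ k"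
    using x by (intro tendsto_intros) (auto simp: S_iff)
  then show ?thesis by (simp add: S_iff step[abs_def])
qed

lemma has_lattice_sum_shift_nat:
  assumes "k \<ge> 1" and "has_lattice_sum k x A"
  shows "has_lattice_sum k (x + real l) A"
proof (induction l)
  case (Suc l)
  from has_lattice_sum_shift[OF assms(1) this] show ?case by (simp add: algebra_simps)
qed (use assms in simp)

text \<open>
  Opposite integers cancel for odd \<open>k\<close> and contribute equally for even \<open>k\<close>.
\<close>

lemma has_lattice_sum_0:
  assumes "k \<ge> 1"
  shows "has_lattice_sum k 0 ((1 + (-1) ^ k) * Li k 1)"
proof (cases "k = 1")
  case True
  moreover have "1 / (- 1 - real j) + 1 / (1 + real j) = 0" for j
    by (simp add: field_simps)
  ultimately show ?thesis by (simp add: has_lattice_sum_def)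
next
  case False
  then have "(\<lambda>j. (1 + (-1) ^ k) * (1 / real (Suc j) ^ k)) sums ((1 + (-1) ^ k) * Li k 1)"
    using assms by (intro sums_mult Li_one_sums) auto
  moreover have "1 / (0 - real (Suc j)) ^ k + 1 / (0 + real (Suc j)) ^ k = (1 + (-1) ^ k) * (1 / real (Suc j) ^ k)" for j
  proof -
    have "(0 - real (Suc j)) ^ k = (-1) ^ k * real (Suc j) ^ k"
      using power_minus[of "real (Suc j)" k] by simp
    then show ?thesis by (cases "even k") (auto simp: field_simps)
  qed
  ultimately show ?thesis using assms by (simp add: has_lattice_sum_def power_0_left)
qed

text \<open>
  For \<open>k \<ge> 2\<close> the negative and the nonnegative half of the lattice give one Lerch series each. For
  \<open>k = 1\<close> these diverge, and the sum is the partial fraction expansion of the cotangent, obtained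
  from the series of the digamma function at \<open>t\<close> and \<open>1 - t\<close>. The argument is the
  negative fraction \<open>- i / n\<close> because \<open>i\<close> stands for the residue class of \<open>- i\<close> modulo \<open>n\<close>.
\<close>

lemma has_lattice_sum_Theta:
  assumes k: "k \<ge> 1" and i: "0 < i" "i < n"
  shows "has_lattice_sum k (- (real i / real n)) ((-1) ^ k * Theta_one k i n)"
proof -
  define t where "t = real i / real n"
  have t: "0 < t" "t < 1" using i by (auto simp: t_def)
  have t': "real (n - i) / real n = 1 - t" using i by (simp add: t_def of_nat_diff field_simps)
  have neg: "(- t - real (Suc j)) ^ k = (-1) ^ k * (real (Suc j) + t) ^ k" for j
  proof -
    have "- t - real (Suc j) = - (real (Suc j) + t)" by simp
    then show ?thesis by (simp only: power_minus[of "real (Suc j) + t" k])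
  qed
  show ?thesis
  proof (cases "k = 1")
    case True
    have D: "(\<lambda>j. inverse (real (Suc j)) - inverse (z + real j)) sums (Digamma z + euler_mascheroni)"
      if "z > 0" for z :: real
      using summable_Digamma[of z] that by (simp add: Digamma_def summable_sums)
    \<comment> \<open>The two digamma series pair \<open>j + 1 - t\<close> with \<open>j + t\<close>; a telescoping series turns the
      latter into \<open>j + 1 + t\<close>.\<close>
    have "(\<lambda>j. inverse (t + real (Suc j)) - inverse (t + real j)) sums (0 - inverse (t + real 0))"
      by (intro telescope_sums filterlim_compose[OF tendsto_inverse_0]
              tendsto_add_filterlim_at_infinity[OF tendsto_const] tendsto_of_nat)
    from sums_diff[OF sums_diff[OF D[of t] D[of "1 - t"]] this]
    have "(\<lambda>j. inverse (1 - t + real j) - inverse (t + real (Suc j))) sums (Digamma t - Digamma (1 - t) + 1 / t)"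
      using t by (simp add: inverse_eq_divide)
    moreover have "Digamma t - Digamma (1 - t) = - (pi * cot (pi * t))"
      using Digamma_reflection[OF t] by simp
    moreover have "inverse (1 - t + real j) - inverse (t + real (Suc j))
        = 1 / (- t - real (Suc j)) ^ 1 + 1 / (- t + real (Suc j)) ^ 1" for j
    proof -
      have e: "- t - real (Suc j) = - (t + real (Suc j))" "- t + real (Suc j) = 1 - t + real j"
        by simp_all
      show ?thesis unfolding e power_one_right inverse_eq_divide divide_minus_right by linarith
    qed
    ultimately show ?thesis
      using True by (simp add: has_lattice_sum_def Theta_one_def t_def[symmetric])
        (simp add: t_def)
  next
    case False
    then have k2: "k \<ge> 2" using k by simp
    have "(\<lambda>j. 1 ^ Suc j / (real (Suc j) + t) ^ k) sums (Lerch_Phi 1 k t - 1 / t ^ k)"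
      using Lerch_Phi_sums[of 1 t k] t k2 by (subst sums_Suc_iff) simp
    from sums_add[OF sums_mult[OF this, of "(-1) ^ k"] Lerch_Phi_sums[of 1 "1 - t" k]]
    have "(\<lambda>j. (-1) ^ k * (1 / (real (Suc j) + t) ^ k) + 1 / (real j + (1 - t)) ^ k) sums
       ((-1) ^ k * (Lerch_Phi 1 k t - 1 / t ^ k) + Lerch_Phi 1 k (1 - t))"
      using t k2 by simp
    moreover have "1 / (- t - real (Suc j)) ^ k + 1 / (- t + real (Suc j)) ^ k
       = (-1) ^ k * (1 / (real (Suc j) + t) ^ k) + 1 / (real j + (1 - t)) ^ k" for j
    proof -
      have "- t + real (Suc j) = real j + (1 - t)" by simp
      then show ?thesis unfolding neg by (cases "even k") (simp_all only:, simp_all)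
    qed
    moreover have "(-1) ^ k * (Lerch_Phi 1 k t - 1 / t ^ k) + Lerch_Phi 1 k (1 - t)
        = (-1) ^ k * Theta_one k i n - 1 / (- t) ^ k"
      using False power_minus[of t k] by (cases "even k") (simp_all add: Theta_one_def t' flip: t_def)
    ultimately show ?thesis by (simp add: has_lattice_sum_def flip: t_def)
  qed
qed

section \<open>The double series over a lattice\<close>

lemma sign_power_mem: "(a::real) \<in> {1, -1} \<Longrightarrow> a ^ n \<in> {1, -1}"
  by (cases "even n") auto

text \<open>
  The multiples \<open>N\<close> and \<open>-N\<close> of \<open>n\<close> are combined into one term, so that the sums over \<open>j\<close>
  are automatically symmetric.
\<close>

lemma summable_on_lattice_terms:
  fixes a :: real and n :: nat
  assumes a: "a \<in> {1, -1}" and n: "n \<ge> 1" and r: "r \<ge> 1" and s: "s \<ge> 2"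
  shows "(\<lambda>(i, j). a ^ Suc i *
      ((1 / (real (Suc i) - real (n * Suc j)) ^ r - 1 / real (Suc i) ^ r) / real (n * Suc j) ^ s
     + (1 / (real (Suc i) + real (n * Suc j)) ^ r - 1 / real (Suc i) ^ r) / (- real (n * Suc j)) ^ s))
     summable_on UNIV" (is "(\<lambda>(i, j). ?f i j) summable_on _")
proof -
  define K where "K = (\<lambda>(x::nat, y::nat). if x = y then 1 / real x ^ 3 else 1 / (real x * real y * \<bar>real x - real y\<bar>))"
  define L where "L = (\<lambda>(x, y). 1 / (real x * real y * real (x + y)))"
  define \<phi> where "\<phi> = (\<lambda>(i, j). (Suc i, n * Suc j))"
  have inj: "inj \<phi>" using n by (auto simp: inj_on_def \<phi>_def)
  have "(\<lambda>z. real r * (K z + L z)) summable_on UNIV"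
    unfolding K_def L_def
    by (intro summable_on_cmult_right summable_on_add summable_on_lattice_kernel summable_on_cubic_kernel)
  then have "(\<lambda>z. real r * (K z + L z)) summable_on range \<phi>"
    by (rule summable_on_subset) simp
  then have major: "(\<lambda>z. real r * (K (\<phi> z) + L (\<phi> z))) summable_on UNIV"
    by (subst (asm) summable_on_reindex[OF inj]) (simp add: o_def)
  have near: "\<bar>(1 / (real x - real y) ^ r - 1 / real x ^ r) / real y ^ s\<bar> \<le> real r * K (x, y)"
    if xy: "x \<ge> 1" "y \<ge> 1" for x y
  proof (cases "x = y")
    case True
    have "real x ^ 3 \<le> real x ^ (r + s)" using r s xy by (intro power_increasing) auto
    then have "1 / real x ^ (r + s) \<le> 1 / real x ^ 3" using xy by (intro divide_left_mono) auto
    also have "\<dots> \<le> real r * (1 / real x ^ 3)" using r mult_right_mono[of 1 "real r" "1 / real x ^ 3"] by simp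
    finally show ?thesis using True r by (simp add: K_def power_add power_0_left)
  next
    case False
    have "\<bar>real x - real y\<bar> \<ge> 1" using False by linarith
    with xy have "\<bar>1 / (real x - real y) ^ r - 1 / real x ^ r\<bar> \<le> real r * (\<bar>real x - real y - real x\<bar> / (\<bar>real x - real y\<bar> * \<bar>real x\<bar>))"
      by (intro abs_inverse_power_diff_le) auto
    also have "\<dots> = real r * (real y / (\<bar>real x - real y\<bar> * real x))" by simp
    finally have 1: "\<bar>1 / (real x - real y) ^ r - 1 / real x ^ r\<bar> \<le> \<dots>" .
    have "real y ^ 2 \<le> real y ^ s" using s xy by (intro power_increasing) auto
    then have "\<bar>1 / (real x - real y) ^ r - 1 / real x ^ r\<bar> / real y ^ s
         \<le> real r * (real y / (\<bar>real x - real y\<bar> * real x)) / real y ^ 2"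
      using 1 xy by (intro frac_le) auto
    also have "\<dots> = real r * K (x, y)" using False xy by (simp add: K_def power2_eq_square mult_ac)
    finally show ?thesis by (simp add: abs_divide)
  qed
  have far: "\<bar>(1 / (real x + real y) ^ r - 1 / real x ^ r) / (- real y) ^ s\<bar> \<le> real r * L (x, y)"
    if xy: "x \<ge> 1" "y \<ge> 1" for x y
  proof -
    have "\<bar>1 / (real x + real y) ^ r - 1 / real x ^ r\<bar> \<le> real r * (\<bar>real x + real y - real x\<bar> / (\<bar>real x + real y\<bar> * \<bar>real x\<bar>))"
      using xy by (intro abs_inverse_power_diff_le) auto
    also have "\<dots> = real r * (real y / ((real x + real y) * real x))" by simp
    finally have 1: "\<bar>1 / (real x + real y) ^ r - 1 / real x ^ r\<bar> \<le> \<dots>" .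
    have "real y ^ 2 \<le> real y ^ s" using s xy by (intro power_increasing) auto
    then have "\<bar>1 / (real x + real y) ^ r - 1 / real x ^ r\<bar> / real y ^ s
         \<le> real r * (real y / ((real x + real y) * real x)) / real y ^ 2"
      using 1 xy by (intro frac_le) auto
    also have "\<dots> = real r * L (x, y)" using xy by (simp add: L_def power2_eq_square mult_ac)
    finally show ?thesis by (simp add: abs_divide power_abs)
  qed
  have "(\<lambda>z. norm (case z of (i, j) \<Rightarrow> ?f i j)) summable_on UNIV"
  proof (rule Infinite_Sum.abs_summable_on_comparison_test'[OF major])
    fix z :: "nat \<times> nat"
    obtain i j where z: "z = (i, j)" by (cases z)
    have pos: "Suc i \<ge> 1" "n * Suc j \<ge> 1" using n by auto
    have "norm (?f i j) \<le> real r * K (Suc i, n * Suc j) + real r * L (Suc i, n * Suc j)"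
      unfolding real_norm_def abs_mult[of "a ^ Suc i"] sign_power_simps(3)[OF a] mult_1
      by (rule order_trans[OF abs_triangle_ineq add_mono[OF near[OF pos] far[OF pos]]])
    then show "norm (case z of (i, j) \<Rightarrow> ?f i j) \<le> real r * (K (\<phi> z) + L (\<phi> z))"
      by (simp only: z \<phi>_def prod.case distrib_left)
  qed
  then show ?thesis by (rule abs_summable_summable)
qed

text \<open>
  The coefficient of \<open>Li_part a r N\<close> is \<open>(-1) ^ r - (-1) ^ s\<close>, which is \<open>2 * (-1) ^ r\<close> for odd
  \<open>r + s\<close>.
\<close>

lemma lattice_column_sums:
  fixes a :: real and N :: nat
  assumes a: "a \<in> {1, -1}" and N: "N \<ge> 1" and r: "r \<ge> 1" and odd: "odd (r + s)"
  shows "(\<lambda>i. a ^ Suc i *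
      ((1 / (real (Suc i) - real N) ^ r - 1 / real (Suc i) ^ r) / real N ^ s
     + (1 / (real (Suc i) + real N) ^ r - 1 / real (Suc i) ^ r) / (- real N) ^ s))
     sums ((1 + (-1) ^ s) * Li r a * ((a ^ N - 1) / real N ^ s)
        + 2 * (-1) ^ r * (a ^ N * Li_part a r N / real N ^ s) - (-1) ^ r / real N ^ (r + s))"
proof -
  have sg: "(- real N) ^ s = (-1) ^ s * real N ^ s" by (rule power_minus)
  have "(\<lambda>i. (1 / real N ^ s) * (a ^ Suc i * (1 / (real (Suc i) - real N) ^ r - 1 / real (Suc i) ^ r))
     + (1 / (- real N) ^ s) * (a ^ Suc i * (1 / (real (Suc i) + real N) ^ r - 1 / real (Suc i) ^ r)))
     sums ((1 / real N ^ s) * ((a ^ N - 1) * Li r a + (-1) ^ r * a ^ N * Li_part a r N - (-1) ^ r / real N ^ r)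
      + (1 / (- real N) ^ s) * (a ^ N * (Li r a - Li_part a r N) - Li r a))"
    by (intro sums_add sums_mult reflected_difference_sums shifted_difference_sums a r N)
  moreover have "(1 / real N ^ s) * ((a ^ N - 1) * Li r a + (-1) ^ r * a ^ N * Li_part a r N - (-1) ^ r / real N ^ r)
      + (1 / (- real N) ^ s) * (a ^ N * (Li r a - Li_part a r N) - Li r a)
     = (1 + (-1) ^ s) * Li r a * ((a ^ N - 1) / real N ^ s)
        + 2 * (-1) ^ r * (a ^ N * Li_part a r N / real N ^ s) - (-1) ^ r / real N ^ (r + s)"
    using odd N unfolding sg by (cases "even r") (auto simp: power_add field_simps)
  moreover have "(1 / real N ^ s) * (a ^ Suc i * (1 / (real (Suc i) - real N) ^ r - 1 / real (Suc i) ^ r))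
     + (1 / (- real N) ^ s) * (a ^ Suc i * (1 / (real (Suc i) + real N) ^ r - 1 / real (Suc i) ^ r))
     = a ^ Suc i *
      ((1 / (real (Suc i) - real N) ^ r - 1 / real (Suc i) ^ r) / real N ^ s
     + (1 / (real (Suc i) + real N) ^ r - 1 / real (Suc i) ^ r) / (- real N) ^ s)" for i
    by (simp only: distrib_left times_divide_eq_right times_divide_eq_left mult_1)
  ultimately show ?thesis by simp
qed

text \<open>
  The symmetric sum of \<open>1 / N ^ k\<close> over the nonzero multiples \<open>N\<close> of \<open>n\<close>.
\<close>

definition zeta_pair :: "nat \<Rightarrow> nat \<Rightarrow> real" where
  "zeta_pair n k = (1 + (-1) ^ k) * Li k 1 / real n ^ k"

lemma zeta_pair_sums:
  assumes "k \<ge> 1"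
  shows "(\<lambda>j. (1 / real (n * Suc j)) ^ k + (1 / (- real (n * Suc j))) ^ k) sums zeta_pair n k"
proof -
  have "(\<lambda>j. 1 / real n ^ k * (1 / (0 - real (Suc j)) ^ k + 1 / (0 + real (Suc j)) ^ k))
     sums (1 / real n ^ k * ((1 + (-1) ^ k) * Li k 1 - 1 / 0 ^ k))"
    by (intro sums_mult has_lattice_sum_0[unfolded has_lattice_sum_def] assms)
  moreover have "1 / real n ^ k * (1 / (0 - real (Suc j)) ^ k + 1 / (0 + real (Suc j)) ^ k)
     = (1 / real (n * Suc j)) ^ k + (1 / (- real (n * Suc j))) ^ k" for j
    unfolding of_nat_mult minus_mult_right power_divide power_mult_distrib
    by (simp add: add_divide_distrib distrib_left del: of_nat_Suc)
  ultimately show ?thesis using assms by (simp add: zeta_pair_def power_0_left)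
qed

text \<open>
  Partial fractions with \<open>X = 1 / (m - N)\<close>, \<open>Y = 1 / N\<close> and \<open>M = 1 / m\<close>. If \<open>N = m\<close>, the relation
  \<open>X * Y = M * (X + Y)\<close> fails since \<open>X = 0\<close>: the left-hand side of the decomposition is zero,
  whereas its right-hand side is a sum of binomial coefficients times \<open>1 / m ^ (r + s)\<close>. This
  produces the correction for \<open>n dvd m\<close>.
\<close>

lemma lattice_row_sums:
  fixes m n :: nat
  assumes m: "m \<ge> 1" and n: "n \<ge> 1" and r: "r \<ge> 1" and s: "s \<ge> 1"
    and A: "\<And>k. k \<ge> 1 \<Longrightarrow> has_lattice_sum k (real m / real n) (A k)"
  shows "(\<lambda>j. (1 / (real m - real (n * Suc j)) ^ r - 1 / real m ^ r) / real (n * Suc j) ^ s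
     + (1 / (real m + real (n * Suc j)) ^ r - 1 / real m ^ r) / (- real (n * Suc j)) ^ s)
     sums ((\<Sum>k=1..r. real ((r + s - k - 1) choose (s - 1)) * (1 / real m) ^ (r + s - k) * (A k / real n ^ k))
       - real ((r + s - 1) choose s) * (1 / real m) ^ (r + s)
       + (\<Sum>k=1..s. real ((r + s - k - 1) choose (r - 1)) * (1 / real m) ^ (r + s - k) * zeta_pair n k)
       - (if n dvd m then real ((r + s - 1) choose r) * (1 / real m) ^ (r + s) else 0)
       - (1 / real m) ^ r * zeta_pair n s)"
proof -
  define N where "N j = real (n * Suc j)" for j
  have N: "N j > 0" for j using n by (simp only: N_def of_nat_0_less_iff) simp
  have m0: "real m > 0" using m by simp
  define c where "c = real ((r + s - 1) choose r) * (1 / real m) ^ (r + s)"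
  define U where "U k = (\<lambda>j. (1 / (real m - N j)) ^ k + (1 / (real m + N j)) ^ k)" for k
  define V where "V k = (\<lambda>j. (1 / N j) ^ k + (1 / (- N j)) ^ k)" for k
  have U: "U k sums (A k / real n ^ k - (1 / real m) ^ k)" if "k \<ge> 1" for k
  proof -
    have "(\<lambda>j. (1 / real n ^ k) * (1 / (real m / real n - real (Suc j)) ^ k + 1 / (real m / real n + real (Suc j)) ^ k))
      sums ((1 / real n ^ k) * (A k - 1 / (real m / real n) ^ k))"
      by (intro sums_mult A[OF that, unfolded has_lattice_sum_def])
    moreover have "(1 / real n ^ k) * (1 / (real m / real n - real (Suc j)) ^ k + 1 / (real m / real n + real (Suc j)) ^ k) = U k j" for j
    proof -
      have "real m - N j = real n * (real m / real n - real (Suc j))"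
        "real m + N j = real n * (real m / real n + real (Suc j))"
        unfolding N_def of_nat_mult using n by (simp_all add: right_diff_distrib distrib_left del: of_nat_Suc)
      moreover have "(1 / real n ^ k) * (1 / x ^ k + 1 / y ^ k) = (1 / (real n * x)) ^ k + (1 / (real n * y)) ^ k" for x y
        by (simp add: power_divide power_mult_distrib distrib_left)
      ultimately show ?thesis by (simp only: U_def)
    qed
    moreover have "(1 / real n ^ k) * (A k - 1 / (real m / real n) ^ k) = A k / real n ^ k - (1 / real m) ^ k"
      using n m by (simp add: power_divide field_simps)
    ultimately show ?thesis by simp
  qed
  have V: "V k sums zeta_pair n k" if "k \<ge> 1" for k
    using zeta_pair_sums[OF that] by (simp add: V_def N_def)
  have D: "(\<lambda>j. if real m = N j then c else 0) sums (if n dvd m then c else 0)"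
  proof (cases "n dvd m")
    case True
    then obtain l where "m = n * Suc l" using m by (metis dvd_def mult_0_right not0_implies_Suc not_one_le_zero)
    then have "(\<lambda>j. if real m = N j then c else 0) = (\<lambda>j. if j = l then c else 0)"
      using n by (auto simp: N_def fun_eq_iff simp flip: of_nat_mult simp del: of_nat_Suc)
    then show ?thesis using sums_single[of l "\<lambda>_. c"] True by simp
  next
    case False
    then have "m \<noteq> n * Suc j" for j by auto
    then have "real m \<noteq> N j" for j unfolding N_def of_nat_eq_iff by blast
    then show ?thesis using False by simp
  qed
  have PF: "(1 / (real m - N j)) ^ r * (1 / N j) ^ s =
      (\<Sum>k=1..r. real ((r + s - k - 1) choose (s - 1)) * (1 / real m) ^ (r + s - k) * (1 / (real m - N j)) ^ k)
    + (\<Sum>k=1..s. real ((r + s - k - 1) choose (r - 1)) * (1 / real m) ^ (r + s - k) * (1 / N j) ^ k)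
    - (if real m = N j then c else 0)" for j
  proof (cases "real m = N j")
    case False
    have "1 / (real m - N j) * (1 / N j) = 1 / real m * (1 / (real m - N j) + 1 / N j)"
      using False N[of j] m0 by (simp add: field_simps)
    from partial_fractions[OF this r s] False show ?thesis by simp
  next
    case True
    have "(\<Sum>k=1..s. real ((r + s - k - 1) choose (r - 1)) * (1 / real m) ^ (r + s - k) * (1 / N j) ^ k)
      = (\<Sum>k=1..s. real ((s + r - k - 1) choose (r - 1))) * (1 / real m) ^ (r + s)"
      unfolding sum_distrib_right
    proof (intro sum.cong refl)
      fix k assume "k \<in> {1..s}"
      then have "(1 / real m) ^ (r + s) = (1 / real m) ^ (r + s - k) * (1 / N j) ^ k"
        unfolding True power_add[symmetric] by simp
      then show "real ((r + s - k - 1) choose (r - 1)) * (1 / real m) ^ (r + s - k) * (1 / N j) ^ k =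
         real ((s + r - k - 1) choose (r - 1)) * (1 / real m) ^ (r + s)"
        by (simp add: add.commute)
    qed
    also have "(\<Sum>k=1..s. real ((s + r - k - 1) choose (r - 1))) = real ((s + r - 1) choose r)"
      using sum_partial_fraction_coeffs[OF s r] by (simp only: of_nat_sum[symmetric])
    finally have "(\<Sum>k=1..s. real ((r + s - k - 1) choose (r - 1)) * (1 / real m) ^ (r + s - k) * (1 / N j) ^ k) = c"
      by (simp add: c_def add.commute)
    moreover have "(\<Sum>k=1..r. real ((r + s - k - 1) choose (s - 1)) * (1 / real m) ^ (r + s - k) * (1 / (real m - N j)) ^ k) = 0"
      by (rule sum.neutral) (use True in \<open>auto simp: power_0_left\<close>)
    ultimately show ?thesis using True r by (simp add: power_0_left)
  qed
  have PF': "(1 / (real m + N j)) ^ r * (1 / (- N j)) ^ s =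
      (\<Sum>k=1..r. real ((r + s - k - 1) choose (s - 1)) * (1 / real m) ^ (r + s - k) * (1 / (real m + N j)) ^ k)
    + (\<Sum>k=1..s. real ((r + s - k - 1) choose (r - 1)) * (1 / real m) ^ (r + s - k) * (1 / (- N j)) ^ k)" for j
  proof -
    have "1 / (real m + N j) * (1 / (- N j)) = 1 / real m * (1 / (real m + N j) + 1 / (- N j))"
      using N[of j] m0 by (simp add: field_simps)
    from partial_fractions[OF this r s] show ?thesis by simp
  qed
  have summand: "(1 / (real m - N j) ^ r - 1 / real m ^ r) / N j ^ s
     + (1 / (real m + N j) ^ r - 1 / real m ^ r) / (- N j) ^ s =
      (\<Sum>k=1..r. real ((r + s - k - 1) choose (s - 1)) * (1 / real m) ^ (r + s - k) * U k j)
    + (\<Sum>k=1..s. real ((r + s - k - 1) choose (r - 1)) * (1 / real m) ^ (r + s - k) * V k j)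
    - (if real m = N j then c else 0) - (1 / real m) ^ r * V s j" for j
  proof -
    have "(1 / (real m - N j) ^ r - 1 / real m ^ r) / N j ^ s
     + (1 / (real m + N j) ^ r - 1 / real m ^ r) / (- N j) ^ s
     = (1 / (real m - N j)) ^ r * (1 / N j) ^ s + (1 / (real m + N j)) ^ r * (1 / (- N j)) ^ s
       - (1 / real m) ^ r * V s j"
      unfolding V_def power_divide power_one by (simp only: diff_divide_distrib) (simp add: algebra_simps)
    then show ?thesis unfolding PF PF' U_def V_def distrib_left sum.distrib by linarith
  qed
  have "(\<lambda>j. (1 / (real m - N j) ^ r - 1 / real m ^ r) / N j ^ s
     + (1 / (real m + N j) ^ r - 1 / real m ^ r) / (- N j) ^ s) sums
     ((\<Sum>k=1..r. real ((r + s - k - 1) choose (s - 1)) * (1 / real m) ^ (r + s - k) * (A k / real n ^ k - (1 / real m) ^ k))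
    + (\<Sum>k=1..s. real ((r + s - k - 1) choose (r - 1)) * (1 / real m) ^ (r + s - k) * zeta_pair n k)
    - (if n dvd m then c else 0) - (1 / real m) ^ r * zeta_pair n s)"
    unfolding summand using s by (intro sums_add sums_diff sums_sum sums_mult U V D) auto
  moreover have "(\<Sum>k=1..r. real ((r + s - k - 1) choose (s - 1)) * (1 / real m) ^ (r + s - k) * (A k / real n ^ k - (1 / real m) ^ k))
     = (\<Sum>k=1..r. real ((r + s - k - 1) choose (s - 1)) * (1 / real m) ^ (r + s - k) * (A k / real n ^ k))
       - real ((r + s - 1) choose s) * (1 / real m) ^ (r + s)"
  proof -
    have "(\<Sum>k=1..r. real ((r + s - k - 1) choose (s - 1)) * (1 / real m) ^ (r + s - k) * (1 / real m) ^ k)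
      = (\<Sum>k=1..r. real ((r + s - k - 1) choose (s - 1)) * (1 / real m) ^ (r + s))"
      by (intro sum.cong refl) (simp add: mult.assoc power_add[symmetric])
    also have "\<dots> = real ((r + s - 1) choose s) * (1 / real m) ^ (r + s)"
      using sum_partial_fraction_coeffs[OF r s] by (simp only: of_nat_sum[symmetric] sum_distrib_right[symmetric])
    finally show ?thesis by (simp add: right_diff_distrib sum_subtractf)
  qed
  ultimately show ?thesis unfolding N_def c_def by simp
qed

lemma sums_residue_classes:
  fixes f :: "nat \<Rightarrow> real"
  assumes n: "n \<ge> 1" and f: "f sums x" and c: "\<And>u. u < n \<Longrightarrow> (\<lambda>l. f (l * n + u)) sums c u"
  shows "x = (\<Sum>u<n. c u)"
proof -
  have "(\<lambda>l. sum f {l * n..<l * n + n}) sums x" using sums_group[OF f] n by simp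
  moreover have "sum f {l * n..<l * n + n} = (\<Sum>u<n. f (l * n + u))" for l
    by (rule sum.reindex_bij_witness[of _ "\<lambda>u. l * n + u" "\<lambda>i. i - l * n"]) auto
  moreover have "(\<lambda>l. \<Sum>u<n. f (l * n + u)) sums (\<Sum>u<n. c u)"
    by (intro sums_sum c) auto
  ultimately show ?thesis using sums_unique2 by simp
qed

text \<open>
  The symmetric sum of \<open>1 / (m / n - j) ^ k\<close> over the integers \<open>j\<close>, as a function of the residue
  class of \<open>m\<close>.
\<close>

definition residue_lattice_sum :: "nat \<Rightarrow> nat \<Rightarrow> nat \<Rightarrow> real" where
  "residue_lattice_sum n m k =
     (if n dvd m then (1 + (-1) ^ k) * Li k 1 else (-1) ^ k * Theta_one k (n - m mod n) n)"

text \<open>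
  By invariance under integer shifts, \<open>m / n\<close> may be replaced by \<open>0\<close> or by \<open>- i / n\<close> with
  \<open>0 < i < n\<close>.
\<close>

lemma has_lattice_sum_residue:
  assumes n: "n \<ge> 1" and k: "k \<ge> 1"
  shows "has_lattice_sum k (real m / real n) (residue_lattice_sum n m k)"
proof (cases "n dvd m")
  case True
  then obtain l where "m = n * l" by (auto simp: dvd_def)
  then show ?thesis
    using has_lattice_sum_shift_nat[OF k has_lattice_sum_0[OF k], of l] n True by (simp add: residue_lattice_sum_def)
next
  case False
  define i where "i = n - m mod n"
  have i: "0 < i" "i < n" using False n by (auto simp: i_def dvd_eq_mod_eq_0)
  have "m + i = n * Suc (m div n)"
  proof -
    have "m mod n < n" using n by simp
    then have "m mod n + i = n" by (simp add: i_def)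
    then show ?thesis using mult_div_mod_eq[of n m] unfolding mult_Suc_right by linarith
  qed
  then have "real m + real i = real n * real (Suc (m div n))"
    by (simp only: of_nat_add[symmetric] of_nat_mult[symmetric])
  then have "real m / real n = - (real i / real n) + real (Suc (m div n))"
    using n by (simp add: field_simps)
  then show ?thesis
    using has_lattice_sum_shift_nat[OF k has_lattice_sum_Theta[OF k i], of "Suc (m div n)"] False
    by (simp add: residue_lattice_sum_def i_def)
qed

text \<open>
  The contribution to the row total of the residue classes of \<open>- i\<close> modulo \<open>n\<close> with
  \<open>0 < i < n\<close>, up to the factor \<open>a ^ n / n ^ (r + s)\<close>.
\<close>

definition Lerch_part :: "real \<Rightarrow> nat \<Rightarrow> nat \<Rightarrow> nat \<Rightarrow> real" where
  "Lerch_part a n r s = (\<Sum>i=1..n-1. \<Sum>k=1..r. real ((r + s - k - 1) choose (s - 1))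
       * a ^ i * (-1) ^ k * Theta_one k i n * Lerch_Phi (a ^ n) (r + s - k) (real (n - i) / real n))"

text \<open>
  The summand for \<open>k = s\<close> in the second sum cancels against the last term. This is what remains of
  the subtraction of \<open>1 / m ^ r\<close>, and it removes the only series \<open>Li (r + s - k) a\<close> that may
  diverge. The terms whose coefficients do not depend on \<open>m\<close> sum to polylogarithm values; the
  others are summed over each residue class modulo \<open>n\<close>.
\<close>

lemma lattice_row_total:
  fixes a :: real and n :: nat
  assumes a: "a \<in> {1, -1}" and n: "n \<ge> 1" and r: "r \<ge> 1" and s: "s \<ge> 2"
    and X: "(\<lambda>i. a ^ Suc i * 
       ((\<Sum>k=1..r. real ((r + s - k - 1) choose (s - 1)) * (1 / real (Suc i)) ^ (r + s - k) * (residue_lattice_sum n (Suc i) k / real n ^ k))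
       - real ((r + s - 1) choose s) * (1 / real (Suc i)) ^ (r + s)
       + (\<Sum>k=1..s. real ((r + s - k - 1) choose (r - 1)) * (1 / real (Suc i)) ^ (r + s - k) * zeta_pair n k)
       - (if n dvd Suc i then real ((r + s - 1) choose r) * (1 / real (Suc i)) ^ (r + s) else 0)
       - (1 / real (Suc i)) ^ r * zeta_pair n s)) sums X"
  shows "X = (\<Sum>k=1..r. real ((r + s - k - 1) choose (s - 1)) * ((1 + (-1) ^ k) * Li k 1) * Li (r + s - k) (a ^ n)) / real n ^ (r + s)
       - real ((r + s - 1) choose r) * Li (r + s) (a ^ n) / real n ^ (r + s)
       + a ^ n * Lerch_part a n r s / real n ^ (r + s)
       - real ((r + s - 1) choose s) * Li (r + s) a
       + (\<Sum>k=1..s-1. real ((r + s - k - 1) choose (r - 1)) * zeta_pair n k * Li (r + s - k) a)"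
proof -
  define w where "w = r + s"
  define T where "T = - real ((w - 1) choose s) * Li w a
       + (\<Sum>k=1..s-1. real ((w - k - 1) choose (r - 1)) * zeta_pair n k * Li (w - k) a)"
  define P where "P m = a ^ m * ((\<Sum>k=1..r. real ((w - k - 1) choose (s - 1)) * (1 / real m) ^ (w - k) * (residue_lattice_sum n m k / real n ^ k))
        - (if n dvd m then real ((w - 1) choose r) * (1 / real m) ^ w else 0))" for m
  have Lia: "(\<lambda>i. a ^ Suc i * (1 / real (Suc i)) ^ t) sums Li t a" if "t \<ge> 2" for t
    using Li_sums[OF a, of t] that by (simp add: power_one_over)
  have Lin: "(\<lambda>i. (a ^ n) ^ Suc i * (1 / real (Suc i)) ^ t) sums Li t (a ^ n)" if "t \<ge> 2" for t
    using Li_sums[OF sign_power_mem[OF a], of t] that by (simp add: power_one_over)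
  have "(\<lambda>i. - real ((w - 1) choose s) * (a ^ Suc i * (1 / real (Suc i)) ^ w)
       + (\<Sum>k=1..s-1. real ((w - k - 1) choose (r - 1)) * zeta_pair n k * (a ^ Suc i * (1 / real (Suc i)) ^ (w - k)))) sums T"
    unfolding T_def by (intro sums_add sums_mult sums_sum Lia) (use r s in \<open>auto simp: w_def\<close>)
  from sums_diff[OF X[folded w_def] this]
  have "(\<lambda>i. P (Suc i)) sums (X - T)"
  proof (rule sums_cong[THEN iffD1, rotated])
    fix i
    have split: "(\<Sum>k=1..s. g k) = (\<Sum>k=1..s-1. g k) + g s" for g :: "nat \<Rightarrow> real"
    proof -
      obtain s' where "s = Suc s'" using s by (cases s) auto
      then show ?thesis by simp
    qed
    have last: "real ((w - s - 1) choose (r - 1)) * (1 / real (Suc i)) ^ (w - s) * zeta_pair n s = (1 / real (Suc i)) ^ r * zeta_pair n s"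
      by (simp add: w_def)
    have pull: "(\<Sum>k=1..s-1. real ((w - k - 1) choose (r - 1)) * zeta_pair n k * (a ^ Suc i * (1 / real (Suc i)) ^ (w - k)))
       = a ^ Suc i * (\<Sum>k=1..s-1. real ((w - k - 1) choose (r - 1)) * (1 / real (Suc i)) ^ (w - k) * zeta_pair n k)"
      unfolding sum_distrib_left by (intro sum.cong refl) (simp only: mult_ac)
    show "a ^ Suc i * 
       ((\<Sum>k=1..r. real ((w - k - 1) choose (s - 1)) * (1 / real (Suc i)) ^ (w - k) * (residue_lattice_sum n (Suc i) k / real n ^ k))
       - real ((w - 1) choose s) * (1 / real (Suc i)) ^ w
       + (\<Sum>k=1..s. real ((w - k - 1) choose (r - 1)) * (1 / real (Suc i)) ^ (w - k) * zeta_pair n k)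
       - (if n dvd Suc i then real ((w - 1) choose r) * (1 / real (Suc i)) ^ w else 0)
       - (1 / real (Suc i)) ^ r * zeta_pair n s)
      - (- real ((w - 1) choose s) * (a ^ Suc i * (1 / real (Suc i)) ^ w)
       + (\<Sum>k=1..s-1. real ((w - k - 1) choose (r - 1)) * zeta_pair n k * (a ^ Suc i * (1 / real (Suc i)) ^ (w - k))))
      = P (Suc i)"
      unfolding P_def split pull last by (simp only: right_diff_distrib distrib_left) simp
  qed
  \<comment> \<open>The indices \<open>l * n + u\<close> belong to \<open>m = l * n + (n - i)\<close> with \<open>i = n - 1 - u\<close>; thus \<open>u = n - 1\<close>
    is the class of the multiples of \<open>n\<close>.\<close>
  define c where "c u = (if u = n - 1 then
       ((\<Sum>k=1..r. real ((w - k - 1) choose (s - 1)) * ((1 + (-1) ^ k) * Li k 1) * Li (w - k) (a ^ n)) 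
       - real ((w - 1) choose r) * Li w (a ^ n)) / real n ^ w
     else a ^ n * (\<Sum>k=1..r. real ((w - k - 1) choose (s - 1)) * a ^ (n - 1 - u) * (-1) ^ k * Theta_one k (n - 1 - u) n
         * Lerch_Phi (a ^ n) (w - k) (real (n - (n - 1 - u)) / real n)) / real n ^ w)" for u
  have "X - T = (\<Sum>u<n. c u)"
  proof (rule sums_residue_classes[OF n \<open>(\<lambda>i. P (Suc i)) sums (X - T)\<close>])
    fix u assume u: "u < n"
    show "(\<lambda>l. P (Suc (l * n + u))) sums c u"
    proof (cases "u = n - 1")
      case True
      have m: "Suc (l * n + u) = n * Suc l" for l using True n by simp
      have "(\<lambda>l. ((\<Sum>k=1..r. real ((w - k - 1) choose (s - 1)) * ((1 + (-1) ^ k) * Li k 1) * ((a ^ n) ^ Suc l * (1 / real (Suc l)) ^ (w - k))) 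
       - real ((w - 1) choose r) * ((a ^ n) ^ Suc l * (1 / real (Suc l)) ^ w)) / real n ^ w) sums c u"
        unfolding c_def if_P[OF True]
        by (intro sums_divide sums_diff sums_sum sums_mult Lin) (use r s in \<open>auto simp: w_def\<close>)
      moreover have "((\<Sum>k=1..r. real ((w - k - 1) choose (s - 1)) * ((1 + (-1) ^ k) * Li k 1) * ((a ^ n) ^ Suc l * (1 / real (Suc l)) ^ (w - k))) 
       - real ((w - 1) choose r) * ((a ^ n) ^ Suc l * (1 / real (Suc l)) ^ w)) / real n ^ w = P (n * Suc l)" for l
      proof -
        have summand: "real ((w - k - 1) choose (s - 1)) * (1 / real (n * Suc l)) ^ (w - k) * (residue_lattice_sum n (n * Suc l) k / real n ^ k)
          = real ((w - k - 1) choose (s - 1)) * ((1 + (-1) ^ k) * Li k 1) * (1 / real (Suc l)) ^ (w - k) / real n ^ w"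
          if "k \<in> {1..r}" for k
        proof -
          have "real n ^ w = real n ^ (w - k) * real n ^ k" using that by (simp add: w_def flip: power_add)
          moreover have "residue_lattice_sum n (n * Suc l) k = (1 + (-1) ^ k) * Li k 1" unfolding residue_lattice_sum_def by (simp only: dvd_triv_left if_True)
          ultimately show ?thesis by (simp add: power_divide power_mult_distrib del: of_nat_Suc mult_Suc_right)
        qed
        have "P (n * Suc l) = (a ^ n) ^ Suc l * ((\<Sum>k=1..r. real ((w - k - 1) choose (s - 1)) * ((1 + (-1) ^ k) * Li k 1) * (1 / real (Suc l)) ^ (w - k) / real n ^ w)
           - real ((w - 1) choose r) * (1 / real (Suc l)) ^ w / real n ^ w)"
          unfolding P_def power_mult[symmetric] using summand
          by (simp add: power_divide power_mult_distrib del: of_nat_Suc mult_Suc_right power_Suc)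
        also have "\<dots> = ((a ^ n) ^ Suc l * (\<Sum>k=1..r. real ((w - k - 1) choose (s - 1)) * ((1 + (-1) ^ k) * Li k 1) * (1 / real (Suc l)) ^ (w - k))
           - (a ^ n) ^ Suc l * (real ((w - 1) choose r) * (1 / real (Suc l)) ^ w)) / real n ^ w"
          by (simp only: sum_divide_distrib[symmetric] right_diff_distrib diff_divide_distrib times_divide_eq_right)
        finally show ?thesis unfolding sum_distrib_left by (simp only: mult_ac)
      qed
      ultimately show ?thesis by (simp only: m)
    next
      case False
      define i where "i = n - 1 - u"
      have i: "0 < i" "i < n" "n - i = Suc u" using u False by (auto simp: i_def)
      have m: "Suc (l * n + u) = l * n + (n - i)" for l using i by simp
      have ndvd: "\<not> n dvd Suc (l * n + u)" and Am: "residue_lattice_sum n (Suc (l * n + u)) k = (-1) ^ k * Theta_one k i n" for l k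
      proof -
        have "Suc (l * n + u) mod n = n - i" unfolding m using i by (simp add: mod_less)
        moreover from this show "\<not> n dvd Suc (l * n + u)" using i by (simp add: dvd_eq_mod_eq_0)
        ultimately show "residue_lattice_sum n (Suc (l * n + u)) k = (-1) ^ k * Theta_one k i n"
          unfolding residue_lattice_sum_def using i(1,2) by simp
      qed
      define t where "t = real (n - i) / real n"
      have t: "t > 0" using i n by (simp add: t_def)
      have mt: "real (Suc (l * n + u)) = real n * (real l + t)" for l
        unfolding m t_def using n by (simp add: algebra_simps)
      have pw: "a ^ Suc (l * n + u) = a ^ n * a ^ i * (a ^ n) ^ l" for l
      proof -
        have "a ^ (n - i) * (a ^ i * a ^ i) = a ^ n * a ^ i" using i(1,2) by (simp flip: power_add)
        then have "a ^ (n - i) = a ^ n * a ^ i" using sign_power_simps(1)[OF a, of i] by simp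
        then show ?thesis unfolding m unfolding power_add mult.commute[of l n] power_mult by (simp add: mult_ac)
      qed
      have "(\<lambda>l. a ^ n * (\<Sum>k=1..r. real ((w - k - 1) choose (s - 1)) * a ^ i * (-1) ^ k * Theta_one k i n
         * ((a ^ n) ^ l / (real l + t) ^ (w - k))) / real n ^ w) sums c u"
        unfolding c_def if_not_P[OF False] i_def[symmetric] t_def[symmetric]
        by (intro sums_divide sums_diff sums_sum sums_mult Lerch_Phi_sums t)
          (use r s sign_power_simps(3)[OF a, of n] in \<open>auto simp: w_def\<close>)
      moreover have "a ^ n * (\<Sum>k=1..r. real ((w - k - 1) choose (s - 1)) * a ^ i * (-1) ^ k * Theta_one k i n
         * ((a ^ n) ^ l / (real l + t) ^ (w - k))) / real n ^ w = P (Suc (l * n + u))" for l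
        unfolding P_def if_not_P[OF ndvd] Am pw mt sum_distrib_left sum_divide_distrib diff_0_right
      proof (intro sum.cong refl)
        fix k assume "k \<in> {1..r}"
        then have "real n ^ w = real n ^ (w - k) * real n ^ k" by (simp add: w_def flip: power_add)
        then show "a ^ n * (real ((w - k - 1) choose (s - 1)) * a ^ i * (-1) ^ k * Theta_one k i n
         * ((a ^ n) ^ l / (real l + t) ^ (w - k))) / real n ^ w
           = a ^ n * a ^ i * (a ^ n) ^ l * (real ((w - k - 1) choose (s - 1)) * (1 / (real n * (real l + t))) ^ (w - k)
               * ((-1) ^ k * Theta_one k i n / real n ^ k))"
          by (simp add: power_divide power_mult_distrib mult_ac)
      qed
      ultimately show ?thesis by simp
    qed
  qed
  also have "(\<Sum>u<n. c u) = (\<Sum>i<n. c (n - 1 - i))"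
    by (rule sum.reindex_bij_witness[of _ "\<lambda>u. n - 1 - u" "\<lambda>u. n - 1 - u"]) auto
  also have "\<dots> = c (n - 1) + (\<Sum>i=1..n-1. c (n - 1 - i))"
  proof -
    have "{..<n} = insert 0 {1..n-1}" using n by auto
    then show ?thesis by simp
  qed
  also have "(\<Sum>i=1..n-1. c (n - 1 - i)) = a ^ n * Lerch_part a n r s / real n ^ w"
    unfolding Lerch_part_def w_def[symmetric] sum_distrib_left[of "a ^ n"] sum_divide_distrib
  proof (intro sum.cong refl)
    fix i assume i: "i \<in> {1..n-1}"
    then have ne: "n - 1 - i \<noteq> n - 1" and e: "n - 1 - (n - 1 - i) = i" by auto
    show "c (n - 1 - i) = (\<Sum>k=1..r. a ^ n * (real ((w - k - 1) choose (s - 1))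
       * a ^ i * (-1) ^ k * Theta_one k i n * Lerch_Phi (a ^ n) (w - k) (real (n - i) / real n)) / real n ^ w)"
      unfolding c_def if_not_P[OF ne] e sum_distrib_left sum_divide_distrib by (rule refl)
  qed
  finally show ?thesis unfolding T_def c_def w_def[symmetric]
    by (simp only: if_True refl diff_divide_distrib)
qed

section \<open>The Euler sums of odd weight\<close>

text \<open>
  The total of the columns equals the total of the rows; this is solved for the only column
  series that does not reduce to polylogarithm values at once.
\<close>

lemma Euler_sum_odd_weight:
  fixes a :: real and n :: nat
  assumes a: "a \<in> {1, -1}" and n: "n \<ge> 1" and r: "r \<ge> 1" and s: "s \<ge> 2" and odd: "odd (r + s)"
  shows "(\<lambda>j. (a ^ n) ^ Suc j * Li_part a r (n * Suc j) / real (Suc j) ^ s) sums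
    ((-1) ^ r * real n ^ s / 2 * 
      ((\<Sum>k=1..r. real ((r + s - k - 1) choose (s - 1)) * ((1 + (-1) ^ k) * Li k 1) * Li (r + s - k) (a ^ n)) / real n ^ (r + s)
       - real ((r + s - 1) choose r) * Li (r + s) (a ^ n) / real n ^ (r + s)
       + a ^ n * Lerch_part a n r s / real n ^ (r + s)
       - real ((r + s - 1) choose s) * Li (r + s) a
       + (\<Sum>k=1..s-1. real ((r + s - k - 1) choose (r - 1)) * zeta_pair n k * Li (r + s - k) a)
       - (1 + (-1) ^ s) * Li r a * (Li s (a ^ n) - Li s 1) / real n ^ s
       + (-1) ^ r * Li (r + s) 1 / real n ^ (r + s)))" (is "_ sums ((-1) ^ r * real n ^ s / 2 * (?X - _ + _))")
proof -
  have sm: "Suc i \<ge> 1" "n * Suc j \<ge> 1" for i j using n by auto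
  have s1: "s \<ge> 1" using s by simp
  obtain X where
    row: "(\<lambda>i. a ^ Suc i * 
       ((\<Sum>k=1..r. real ((r + s - k - 1) choose (s - 1)) * (1 / real (Suc i)) ^ (r + s - k) * (residue_lattice_sum n (Suc i) k / real n ^ k))
       - real ((r + s - 1) choose s) * (1 / real (Suc i)) ^ (r + s)
       + (\<Sum>k=1..s. real ((r + s - k - 1) choose (r - 1)) * (1 / real (Suc i)) ^ (r + s - k) * zeta_pair n k)
       - (if n dvd Suc i then real ((r + s - 1) choose r) * (1 / real (Suc i)) ^ (r + s) else 0)
       - (1 / real (Suc i)) ^ r * zeta_pair n s)) sums X"
   and col: "(\<lambda>j. (1 + (-1) ^ s) * Li r a * ((a ^ (n * Suc j) - 1) / real (n * Suc j) ^ s)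
        + 2 * (-1) ^ r * (a ^ (n * Suc j) * Li_part a r (n * Suc j) / real (n * Suc j) ^ s) - (-1) ^ r / real (n * Suc j) ^ (r + s)) sums X"
    by (rule double_series_exchange[OF summable_on_lattice_terms[OF a n r s]
        sums_mult[OF lattice_row_sums[OF sm(1) n r s1 has_lattice_sum_residue[OF n]]] lattice_column_sums[OF a sm(2) r odd]])
  have Xeq: "X = ?X" by (rule lattice_row_total[OF a n r s row])
  have Lis: "(\<lambda>j. (a ^ n) ^ Suc j / real (Suc j) ^ s) sums Li s (a ^ n)"
    using Li_sums[OF sign_power_mem[OF a] s1] s by simp
  have "(\<lambda>j. (-1) ^ r * real n ^ s / 2 * (((1 + (-1) ^ s) * Li r a * ((a ^ (n * Suc j) - 1) / real (n * Suc j) ^ s)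
        + 2 * (-1) ^ r * (a ^ (n * Suc j) * Li_part a r (n * Suc j) / real (n * Suc j) ^ s) - (-1) ^ r / real (n * Suc j) ^ (r + s))
      - (1 + (-1) ^ s) * Li r a * ((a ^ n) ^ Suc j / real (Suc j) ^ s - 1 / real (Suc j) ^ s) / real n ^ s
      + (-1) ^ r * (1 / real (Suc j) ^ (r + s)) / real n ^ (r + s)))
     sums ((-1) ^ r * real n ^ s / 2 * (X - (1 + (-1) ^ s) * Li r a * (Li s (a ^ n) - Li s 1) / real n ^ s
       + (-1) ^ r * Li (r + s) 1 / real n ^ (r + s)))"
    using r s by (intro sums_mult sums_add sums_diff sums_divide col Lis Li_one_sums) auto
  moreover have "(-1) ^ r * real n ^ s / 2 * (((1 + (-1) ^ s) * Li r a * ((a ^ (n * Suc j) - 1) / real (n * Suc j) ^ s)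
        + 2 * (-1) ^ r * (a ^ (n * Suc j) * Li_part a r (n * Suc j) / real (n * Suc j) ^ s) - (-1) ^ r / real (n * Suc j) ^ (r + s))
      - (1 + (-1) ^ s) * Li r a * ((a ^ n) ^ Suc j / real (Suc j) ^ s - 1 / real (Suc j) ^ s) / real n ^ s
      + (-1) ^ r * (1 / real (Suc j) ^ (r + s)) / real n ^ (r + s))
     = (a ^ n) ^ Suc j * Li_part a r (n * Suc j) / real (Suc j) ^ s" for j
  proof -
    define J where "J = real (Suc j)"
    define E where "E = (a ^ n) ^ Suc j"
    define h where "h = Li_part a r (n * Suc j)"
    have nJ: "real n > 0" "J > 0" using n by (simp_all add: J_def)
    have "(-1) ^ r * (-1) ^ r = (1::real)" by (simp flip: power_mult_distrib)
    then have "(-1) ^ r * real n ^ s / 2 * (2 * (-1) ^ r * (E * h / (real n ^ s * J ^ s))) = E * h / J ^ s"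
      using nJ by (simp add: mult_ac)
    moreover have "(((1 + (-1) ^ s) * Li r a * ((E - 1) / (real n ^ s * J ^ s))
        + 2 * (-1) ^ r * (E * h / (real n ^ s * J ^ s)) - (-1) ^ r / (real n ^ (r + s) * J ^ (r + s)))
      - (1 + (-1) ^ s) * Li r a * (E / J ^ s - 1 / J ^ s) / real n ^ s
      + (-1) ^ r * (1 / J ^ (r + s)) / real n ^ (r + s)) = 2 * (-1) ^ r * (E * h / (real n ^ s * J ^ s))"
      by (simp add: diff_divide_distrib[symmetric] mult.commute)
    ultimately show ?thesis
      unfolding of_nat_mult power_mult power_mult_distrib J_def[symmetric] E_def[symmetric] h_def[symmetric] by simp
  qed
  ultimately show ?thesis unfolding Xeq by simp
qed

lemma sum_even_indices:
  fixes g :: "nat \<Rightarrow> real"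
  shows "(\<Sum>k=1..r. (1 + (-1) ^ k) * g k) = 2 * (\<Sum>i=1..r div 2. g (2 * i))"
proof (induction r)
  case (Suc r)
  then show ?case
    by (cases "even r") (auto simp: elim!: evenE oddE)
qed simp

text \<open>
  The terms with coefficient \<open>1 + (-1) ^ k\<close> live on even \<open>k = 2 * i\<close>. The summand \<open>i = 0\<close>, with
  \<open>Li 0 1 = - 1 / 2\<close>, absorbs the terms of full weight \<open>r + s\<close>, and the zeta value from the columns
  supplies the missing summand \<open>k = s\<close> of the second sum.
\<close>

lemma Euler_sum_odd_weight_closed_form:
  fixes a :: real and n :: nat
  assumes a: "a \<in> {1, -1}" and n: "n \<ge> 1" and r: "r \<ge> 1" and s: "s \<ge> 2" and odd: "odd (r + s)"
  shows "(\<lambda>j. (a ^ n) ^ Suc j * Li_part a r (n * Suc j) / real (Suc j) ^ s) sums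
    (a * (a / 2 * (1 + (-1) ^ s) * Li s (a ^ n) * Li r a
         + a / (2 * real n ^ r) * Li (r + s) 1
         - (-1) ^ s * real n ^ s * a * (\<Sum>i=0..s div 2. real ((r + s - 2 * i - 1) choose (r - 1))
             / real n ^ (2 * i) * Li (2 * i) 1 * Li (r + s - 2 * i) a)
         + (-1) ^ r * a / real n ^ r * (\<Sum>i=0..r div 2. real ((r + s - 2 * i - 1) choose (s - 1))
             * Li (2 * i) 1 * Li (r + s - 2 * i) (a ^ n))
         + (-1) ^ r * a ^ (n + 1) / (2 * real n ^ r) * Lerch_part a n r s))" (is "_ sums (a * ?R)")
proof -
  define w where "w = r + s"
  define B1 where "B1 = (\<Sum>i=0..r div 2. real ((w - 2 * i - 1) choose (s - 1)) * Li (2 * i) 1 * Li (w - 2 * i) (a ^ n))"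
  define B2 where "B2 = (\<Sum>i=0..s div 2. real ((w - 2 * i - 1) choose (r - 1)) / real n ^ (2 * i) * Li (2 * i) 1 * Li (w - 2 * i) a)"
  have Li0: "Li 0 1 = - 1 / 2" by (simp add: Li_def)
  have c1: "(w - 1) choose r = (w - 1) choose (s - 1)"
    using binomial_symmetric[of r "w - 1"] r s by (simp add: w_def)
  have c2: "(w - 1) choose s = (w - 1) choose (r - 1)"
    using binomial_symmetric[of s "w - 1"] r s by (simp add: w_def)
  have split0: "(\<Sum>i=0..m. g i) = g 0 + (\<Sum>i=1..m. g i)" for m and g :: "nat \<Rightarrow> real"
    by (simp add: sum.atLeast_Suc_atMost)
  have "(\<Sum>k=1..r. real ((w - k - 1) choose (s - 1)) * ((1 + (-1) ^ k) * Li k 1) * Li (w - k) (a ^ n))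
      = (\<Sum>k=1..r. (1 + (-1) ^ k) * (real ((w - k - 1) choose (s - 1)) * Li k 1 * Li (w - k) (a ^ n)))"
    by (intro sum.cong refl) (simp only: mult_ac)
  then have 1: "(\<Sum>k=1..r. real ((w - k - 1) choose (s - 1)) * ((1 + (-1) ^ k) * Li k 1) * Li (w - k) (a ^ n))
      - real ((w - 1) choose r) * Li w (a ^ n) = 2 * B1"
    unfolding sum_even_indices B1_def split0 c1 by (simp add: Li0)
  have last: "(\<Sum>k=1..s. g k) = (\<Sum>k=1..s-1. g k) + g s" for g :: "nat \<Rightarrow> real"
  proof -
    obtain s' where "s = Suc s'" using s by (cases s) auto
    then show ?thesis by simp
  qed
  have "(\<Sum>k=1..s. real ((w - k - 1) choose (r - 1)) * zeta_pair n k * Li (w - k) a)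
      = (\<Sum>k=1..s. (1 + (-1) ^ k) * (real ((w - k - 1) choose (r - 1)) / real n ^ k * Li k 1 * Li (w - k) a))"
    unfolding zeta_pair_def by (intro sum.cong refl) simp
  then have 2: "- real ((w - 1) choose s) * Li w a + (\<Sum>k=1..s-1. real ((w - k - 1) choose (r - 1)) * zeta_pair n k * Li (w - k) a)
      = 2 * B2 - zeta_pair n s * Li r a"
    unfolding sum_even_indices B2_def split0 c2 unfolding last by (simp add: Li0 w_def)
  have nw: "real n ^ s * (x / real n ^ w) = x / real n ^ r" for x
    using n by (simp add: w_def power_add)
  have sgn: "(-1) ^ r * (-1) ^ r = (1::real)" "(-1) ^ s = - ((-1) ^ r :: real)"
    using odd by (auto simp flip: power_mult_distrib)
  have "(-1) ^ r * real n ^ s / 2 * (2 * B1 / real n ^ w + a ^ n * Lerch_part a n r s / real n ^ w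
      + (2 * B2 - zeta_pair n s * Li r a) - (1 + (-1) ^ s) * Li r a * (Li s (a ^ n) - Li s 1) / real n ^ s
      + (-1) ^ r * Li w 1 / real n ^ w)
    = (-1) ^ r / 2 * (real n ^ s * (2 * B1 / real n ^ w) + real n ^ s * (a ^ n * Lerch_part a n r s / real n ^ w)
      + real n ^ s * 2 * B2 - (1 + (-1) ^ s) * Li r a * Li s (a ^ n) + (-1) ^ r * (real n ^ s * (Li w 1 / real n ^ w)))"
    unfolding zeta_pair_def using n by (simp add: field_simps)
  also have "\<dots> = (-1) ^ r / 2 * (2 * B1 / real n ^ r + a ^ n * Lerch_part a n r s / real n ^ r
      + real n ^ s * 2 * B2 - (1 + (-1) ^ s) * Li r a * Li s (a ^ n) + (-1) ^ r * (Li w 1 / real n ^ r))"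
    unfolding nw ..
  also have "\<dots> = (a * a) * (1 / 2 * (1 + (-1) ^ s) * Li s (a ^ n) * Li r a + 1 / (2 * real n ^ r) * Li w 1
     - (-1) ^ s * real n ^ s * B2 + (-1) ^ r / real n ^ r * B1 + (-1) ^ r * a ^ n / (2 * real n ^ r) * Lerch_part a n r s)"
    using a sgn(2) by (cases "even r") (auto simp: field_simps)
  also have "\<dots> = a * ?R"
    unfolding B1_def[symmetric, unfolded w_def] B2_def[symmetric, unfolded w_def] w_def
    by (simp add: algebra_simps)
  finally have eq: "(-1) ^ r * real n ^ s / 2 * (2 * B1 / real n ^ w + a ^ n * Lerch_part a n r s / real n ^ w
      + (2 * B2 - zeta_pair n s * Li r a) - (1 + (-1) ^ s) * Li r a * (Li s (a ^ n) - Li s 1) / real n ^ s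
      + (-1) ^ r * Li w 1 / real n ^ w) = a * ?R" .
  have rearr: "x / y - z / y + l - b + c = (x - z) / y + l + (- b + c)" for x y z l b c :: real
    by (simp add: diff_divide_distrib)
  show ?thesis
    using Euler_sum_odd_weight[OF a n r s odd]
    unfolding rearr w_def[symmetric] 1 mult_minus_left[symmetric] 2 eq[unfolded w_def] by (simp only: eq[symmetric] w_def)
qed

section \<open>The series of generalized harmonic numbers\<close>

lemma summable_on_gen_harm_terms:
  fixes a :: real and n :: nat
  assumes a: "a \<in> {1, -1}" and n: "n \<ge> 1" and q: "q \<ge> 2"
  shows "(\<lambda>(k, j). a ^ Suc k * (1 / real (Suc j) ^ p - 1 / (real (Suc j) + real (Suc k) / real n) ^ p) / real (Suc k) ^ q)
     summable_on UNIV" (is "(\<lambda>(k, j). ?f k j) summable_on _")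
proof -
  define L where "L = (\<lambda>(x, y). 1 / (real x * real y * real (x + y)))"
  define \<phi> where "\<phi> = (\<lambda>(i, j). (Suc i, Suc j))"
  have inj: "inj \<phi>" by (auto simp: inj_on_def \<phi>_def)
  have "(\<lambda>z. real p * L z) summable_on UNIV"
    unfolding L_def by (intro summable_on_cmult_right summable_on_cubic_kernel)
  then have "(\<lambda>z. real p * L z) summable_on range \<phi>"
    by (rule summable_on_subset) simp
  then have major: "(\<lambda>z. real p * L (\<phi> z)) summable_on UNIV"
    by (subst (asm) summable_on_reindex[OF inj]) (simp add: o_def)
  have bound: "\<bar>1 / real J ^ p - 1 / (real J + real K / real n) ^ p\<bar> / real K ^ q \<le> real p * L (K, J)"
    if JK: "J \<ge> 1" "K \<ge> 1" for J K
  proof -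
    have "\<bar>1 / real J ^ p - 1 / (real J + real K / real n) ^ p\<bar>
       \<le> real p * (\<bar>real J - (real J + real K / real n)\<bar> / (\<bar>real J\<bar> * \<bar>real J + real K / real n\<bar>))"
      using JK by (intro abs_inverse_power_diff_le) (auto simp: abs_of_nonneg intro: add_increasing2)
    also have "\<dots> = real p * (real K / (real J * (real n * real J + real K)))"
      using JK n by (simp add: abs_of_nonneg field_simps)
    also have "\<dots> \<le> real p * (real K / (real J * (real J + real K)))"
      using JK n by (intro mult_left_mono divide_left_mono mult_left_mono add_right_mono mult_pos_pos add_pos_pos) auto
    finally have 1: "\<bar>1 / real J ^ p - 1 / (real J + real K / real n) ^ p\<bar> \<le> \<dots>" .
    have "real K ^ 2 \<le> real K ^ q" using q JK by (intro power_increasing) auto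
    then have "\<bar>1 / real J ^ p - 1 / (real J + real K / real n) ^ p\<bar> / real K ^ q
         \<le> real p * (real K / (real J * (real J + real K))) / real K ^ 2"
      using 1 JK by (intro frac_le) auto
    also have "\<dots> = real p * L (K, J)" using JK by (simp add: L_def power2_eq_square mult_ac add.commute)
    finally show ?thesis .
  qed
  have "(\<lambda>z. norm (case z of (k, j) \<Rightarrow> ?f k j)) summable_on UNIV"
  proof (rule Infinite_Sum.abs_summable_on_comparison_test'[OF major])
    fix z :: "nat \<times> nat"
    obtain k j where z: "z = (k, j)" by (cases z)
    have "norm (?f k j) \<le> real p * L (Suc k, Suc j)"
      using bound[of "Suc j" "Suc k"] unfolding real_norm_def abs_divide abs_mult[of "a ^ Suc k"] sign_power_simps(3)[OF a]
      by (simp add: power_abs del: of_nat_Suc)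
    then show "norm (case z of (k, j) \<Rightarrow> ?f k j) \<le> real p * L (\<phi> z)"
      by (simp only: z \<phi>_def prod.case)
  qed
  then show ?thesis by (rule abs_summable_summable)
qed

lemma gen_harm_sums:
  assumes x: "x > 0"
  shows "(\<lambda>j. 1 / real (Suc j) ^ p - 1 / (real (Suc j) + x) ^ p) sums gen_harm p x"
proof -
  have "summable (\<lambda>j. 1 / real (Suc j) ^ p - 1 / (real (Suc j) + x) ^ p)"
  proof (rule summable_comparison_test'[where N = 0])
    show "summable (\<lambda>j. real p * x * (1 / real (Suc j) ^ 2))"
      by (intro summable_mult sums_summable[OF Li_one_sums]) simp
    fix j
    have "\<bar>1 / real (Suc j) ^ p - 1 / (real (Suc j) + x) ^ p\<bar>
       \<le> real p * (\<bar>real (Suc j) - (real (Suc j) + x)\<bar> / (\<bar>real (Suc j)\<bar> * \<bar>real (Suc j) + x\<bar>))"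
      using x by (intro abs_inverse_power_diff_le) auto
    also have "\<dots> = real p * (x / (real (Suc j) * (real (Suc j) + x)))" using x by simp
    also have "\<dots> \<le> real p * (x / (real (Suc j) * real (Suc j)))"
      using x by (intro mult_left_mono divide_left_mono mult_pos_pos) auto
    finally show "norm (1 / real (Suc j) ^ p - 1 / (real (Suc j) + x) ^ p) \<le> real p * x * (1 / real (Suc j) ^ 2)"
      by (simp add: power2_eq_square)
  qed
  then show ?thesis by (simp add: gen_harm_def summable_sums)
qed

text \<open>
  Partial fractions with \<open>X = - 1 / k\<close>, \<open>Y = 1 / (N + k)\<close> and \<open>M = 1 / N\<close>, where \<open>N = n * J\<close>. The
  summand with \<open>X ^ q\<close> cancels against \<open>1 / J ^ p\<close>. The summands with \<open>X\<close> and \<open>Y\<close> to the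
  first power have the same coefficient and are kept together, because for \<open>a = 1\<close> only their sum
  converges.
\<close>

lemma gen_harm_column_sums:
  fixes a :: real and n :: nat
  assumes a: "a \<in> {1, -1}" and n: "n \<ge> 1" and p: "p \<ge> 1" and q: "q \<ge> 2" and J: "J \<ge> 1"
  shows "(\<lambda>k. a ^ Suc k * (1 / real J ^ p - 1 / (real J + real (Suc k) / real n) ^ p) / real (Suc k) ^ q)
    sums (- ((-1) ^ q * real n ^ p) *
      ((\<Sum>l=2..q-1. real ((p + q - l - 1) choose (q - l)) * (1 / real (n * J)) ^ (p + q - l) * ((-1) ^ l * Li l a))
     + (\<Sum>r=2..p. real ((p + q - r - 1) choose (p - r)) * (1 / real (n * J)) ^ (p + q - r) * (a ^ (n * J) * (Li r a - Li_part a r (n * J))))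
     + real ((p + q - 2) choose (q - 1)) * (1 / real (n * J)) ^ (p + q - 1) * (a ^ (n * J) * (Li 1 a - Li_part a 1 (n * J)) - Li 1 a)))"
proof -
  define N where "N = n * J"
  have N: "real N > 0" using n J by (simp add: N_def)
  define K where "K k = real (Suc k)" for k
  have K: "K k > 0" for k by (simp add: K_def)
  have inner: "a ^ Suc k * (1 / real J ^ p - 1 / (real J + K k / real n) ^ p) / K k ^ q
     = - ((-1) ^ q * real n ^ p) *
      ((\<Sum>l=2..q-1. real ((p + q - l - 1) choose (q - l)) * (1 / real N) ^ (p + q - l) * ((-1) ^ l * (a ^ Suc k / K k ^ l)))
     + (\<Sum>r=2..p. real ((p + q - r - 1) choose (p - r)) * (1 / real N) ^ (p + q - r)
         * (a ^ Suc k * (1 / (K k + real N) ^ r - 1 / K k ^ r) + a ^ Suc k / K k ^ r))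
     + real ((p + q - 2) choose (q - 1)) * (1 / real N) ^ (p + q - 1) * (a ^ Suc k * (1 / (K k + real N) ^ 1 - 1 / K k ^ 1)))" for k
  proof -
    define X where "X = - (1 / K k)"
    define Y where "Y = 1 / (K k + real N)"
    define M where "M = 1 / real N"
    have XY: "X * Y = M * (X + Y)" using K[of k] N by (simp add: X_def Y_def M_def field_simps)
    have q1: "q \<ge> 1" using q by simp
    have choose_symm: "(p + q - 2) choose (p - 1) = (p + q - 2) choose (q - 1)"
    proof -
      have "p - 1 \<le> p + q - 2" "p + q - 2 - (p - 1) = q - 1" using p q by auto
      then show ?thesis using binomial_symmetric[of "p - 1" "p + q - 2"] by simp
    qed
    have b1: "(q + p - l - 1) choose (p - 1) = (p + q - l - 1) choose (q - l)" if "l \<in> {1..q}" for l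
    proof -
      have "p - 1 \<le> p + q - l - 1" "p + q - l - 1 - (p - 1) = q - l" "q + p - l - 1 = p + q - l - 1"
        using p that by auto
      then show ?thesis using binomial_symmetric[of "p - 1" "p + q - l - 1"] by simp
    qed
    have b2: "(q + p - r - 1) choose (q - 1) = (p + q - r - 1) choose (p - r)" if "r \<in> {1..p}" for r
    proof -
      have "q - 1 \<le> p + q - r - 1" "p + q - r - 1 - (q - 1) = p - r" "q + p - r - 1 = p + q - r - 1"
        using q that by auto
      then show ?thesis using binomial_symmetric[of "q - 1" "p + q - r - 1"] by simp
    qed
    have "X ^ q * Y ^ p = (\<Sum>l=1..q. real ((q + p - l - 1) choose (p - 1)) * M ^ (q + p - l) * X ^ l)
       + (\<Sum>r=1..p. real ((q + p - r - 1) choose (q - 1)) * M ^ (q + p - r) * Y ^ r)"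
      by (rule partial_fractions[OF XY q1 p])
    also have "(\<Sum>l=1..q. real ((q + p - l - 1) choose (p - 1)) * M ^ (q + p - l) * X ^ l)
        = (\<Sum>l=1..q. real ((p + q - l - 1) choose (q - l)) * M ^ (p + q - l) * X ^ l)"
      using b1 by (intro sum.cong refl) (simp add: add.commute)
    also have "\<dots> = real ((p + q - 2) choose (q - 1)) * M ^ (p + q - 1) * X
         + (\<Sum>l=2..q-1. real ((p + q - l - 1) choose (q - l)) * M ^ (p + q - l) * X ^ l) + M ^ p * X ^ q"
    proof -
      have "{1..q} = insert 1 (insert q {2..q-1})" using q by auto
      then have ends: "(\<Sum>l=1..q. g l) = g 1 + (\<Sum>l=2..q-1. g l) + g q" for g :: "nat \<Rightarrow> real"
        using q by simp
      show ?thesis unfolding ends by (simp add: numeral_2_eq_2)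
    qed
    also have "(\<Sum>r=1..p. real ((q + p - r - 1) choose (q - 1)) * M ^ (q + p - r) * Y ^ r)
        = (\<Sum>r=1..p. real ((p + q - r - 1) choose (p - r)) * M ^ (p + q - r) * Y ^ r)"
      using b2 by (intro sum.cong refl) (simp add: add.commute)
    also have "\<dots> = real ((p + q - 2) choose (p - 1)) * M ^ (p + q - 1) * Y
         + (\<Sum>r=2..p. real ((p + q - r - 1) choose (p - r)) * M ^ (p + q - r) * Y ^ r)"
    proof -
      have "{1..p} = insert 1 {2..p}" using p by auto
      then show ?thesis by (simp add: numeral_2_eq_2)
    qed
    also have "(p + q - 2) choose (p - 1) = (p + q - 2) choose (q - 1)"
      by (rule choose_symm)
    finally have PF: "X ^ q * Y ^ p - M ^ p * X ^ q =
        (\<Sum>l=2..q-1. real ((p + q - l - 1) choose (q - l)) * M ^ (p + q - l) * X ^ l)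
      + (\<Sum>r=2..p. real ((p + q - r - 1) choose (p - r)) * M ^ (p + q - r) * Y ^ r)
      + real ((p + q - 2) choose (q - 1)) * M ^ (p + q - 1) * (X + Y)"
      by (simp add: algebra_simps)
    have Xp: "X ^ l = (-1) ^ l * (1 / K k ^ l)" for l
      unfolding X_def using power_minus[of "1 / K k" l] by (simp add: power_divide)
    have "1 / real J = real n * M" using n J by (simp add: M_def N_def)
    then have J': "1 / real J ^ p = real n ^ p * M ^ p"
      by (simp add: power_mult_distrib flip: power_one_over)
    have "1 / (real J + K k / real n) = real n * Y"
      using n by (simp add: Y_def N_def field_simps)
    then have JK': "1 / (real J + K k / real n) ^ p = real n ^ p * Y ^ p"
      by (simp add: power_mult_distrib flip: power_one_over)
    have "(1 / real J ^ p - 1 / (real J + K k / real n) ^ p) * (1 / K k ^ q)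
       = - ((-1) ^ q * real n ^ p) * (X ^ q * Y ^ p - M ^ p * X ^ q)"
      unfolding J' JK' Xp by (cases "even q") (simp_all add: algebra_simps)
    moreover have "u * v / z = u * (v * (1 / z))" "u * (v * z) = v * (u * z)" for u v z :: real
      by simp_all
    ultimately have "a ^ Suc k * (1 / real J ^ p - 1 / (real J + K k / real n) ^ p) / K k ^ q
       = - ((-1) ^ q * real n ^ p) * (a ^ Suc k * (X ^ q * Y ^ p - M ^ p * X ^ q))"
      by metis
    also have "a ^ Suc k * (X ^ q * Y ^ p - M ^ p * X ^ q) =
        (\<Sum>l=2..q-1. real ((p + q - l - 1) choose (q - l)) * M ^ (p + q - l) * (a ^ Suc k * X ^ l))
      + (\<Sum>r=2..p. real ((p + q - r - 1) choose (p - r)) * M ^ (p + q - r) * (a ^ Suc k * Y ^ r))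
      + real ((p + q - 2) choose (q - 1)) * M ^ (p + q - 1) * (a ^ Suc k * (X + Y))"
      unfolding PF distrib_left sum_distrib_left by (simp only: mult_ac)
    also have "(\<lambda>l. a ^ Suc k * X ^ l) = (\<lambda>l. (-1) ^ l * (a ^ Suc k / K k ^ l))"
      by (simp add: Xp mult_ac)
    also have "(\<lambda>r. a ^ Suc k * Y ^ r) = (\<lambda>r. a ^ Suc k * (1 / (K k + real N) ^ r - 1 / K k ^ r) + a ^ Suc k / K k ^ r)"
      by (simp add: Y_def power_one_over right_diff_distrib)
    also have "X + Y = 1 / (K k + real N) ^ 1 - 1 / K k ^ 1" by (simp add: X_def Y_def)
    finally show ?thesis unfolding M_def .
  qed
  have Li2: "(\<lambda>k. a ^ Suc k / K k ^ l) sums Li l a" if "l \<ge> 2" for l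
    using Li_sums[OF a, of l] that by (simp add: K_def)
  have Sh: "(\<lambda>k. a ^ Suc k * (1 / (K k + real N) ^ r - 1 / K k ^ r)) sums (a ^ N * (Li r a - Li_part a r N) - Li r a)"
    if "r \<ge> 1" for r using shifted_difference_sums[OF a that, of N] by (simp only: K_def)
  have "(\<lambda>k. a ^ Suc k * (1 / real J ^ p - 1 / (real J + K k / real n) ^ p) / K k ^ q) sums
    (- ((-1) ^ q * real n ^ p) *
      ((\<Sum>l=2..q-1. real ((p + q - l - 1) choose (q - l)) * (1 / real N) ^ (p + q - l) * ((-1) ^ l * Li l a))
     + (\<Sum>r=2..p. real ((p + q - r - 1) choose (p - r)) * (1 / real N) ^ (p + q - r) * (a ^ N * (Li r a - Li_part a r N) - Li r a + Li r a))
     + real ((p + q - 2) choose (q - 1)) * (1 / real N) ^ (p + q - 1) * (a ^ N * (Li 1 a - Li_part a 1 N) - Li 1 a)))"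
    unfolding inner by (intro sums_mult sums_add sums_sum Li2 Sh) auto
  then show ?thesis by (simp only: diff_add_cancel N_def K_def)
qed

text \<open>
  The rows are summed by the definition of the generalized harmonic numbers. Summed over \<open>j\<close>, the
  columns leave zeta and polylogarithm values and the Euler sums, whose values enter as \<open>E r\<close>.
\<close>

lemma gen_harm_series:
  fixes a :: real and n :: nat
  assumes a: "a \<in> {1, -1}" and n: "n \<ge> 1" and p: "p \<ge> 1" and q: "q \<ge> 2"
    and E: "\<And>r. r \<in> {1..p} \<Longrightarrow> (\<lambda>j. (a ^ n) ^ Suc j * Li_part a r (n * Suc j) / real (Suc j) ^ (p + q - r)) sums E r"
  shows "(\<lambda>k. a ^ Suc k * gen_harm p (real (Suc k) / real n) / real (Suc k) ^ q) sums
    (- ((-1) ^ q * real n ^ p) *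
      ((\<Sum>l=2..q-1. real ((p + q - l - 1) choose (q - l)) * ((-1) ^ l * Li l a) * (Li (p + q - l) 1 / real n ^ (p + q - l)))
     + (\<Sum>r=2..p. real ((p + q - r - 1) choose (p - r)) * ((Li r a * Li (p + q - r) (a ^ n) - E r) / real n ^ (p + q - r)))
     + real ((p + q - 2) choose (q - 1)) * ((Li 1 a * (Li (p + q - 1) (a ^ n) - Li (p + q - 1) 1) - E 1) / real n ^ (p + q - 1))))"
    (is "_ sums ?V")
proof -
  have rows: "(\<lambda>j. a ^ Suc k * (1 / real (Suc j) ^ p - 1 / (real (Suc j) + real (Suc k) / real n) ^ p) / real (Suc k) ^ q)
      sums (a ^ Suc k * gen_harm p (real (Suc k) / real n) / real (Suc k) ^ q)" for k
    by (intro sums_divide sums_mult gen_harm_sums) (use n in auto)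
  have sj: "Suc j \<ge> 1" for j by simp
  obtain V where V: "(\<lambda>k. a ^ Suc k * gen_harm p (real (Suc k) / real n) / real (Suc k) ^ q) sums V"
    and col: "(\<lambda>j. - ((-1) ^ q * real n ^ p) *
      ((\<Sum>l=2..q-1. real ((p + q - l - 1) choose (q - l)) * (1 / real (n * Suc j)) ^ (p + q - l) * ((-1) ^ l * Li l a))
     + (\<Sum>r=2..p. real ((p + q - r - 1) choose (p - r)) * (1 / real (n * Suc j)) ^ (p + q - r) * (a ^ (n * Suc j) * (Li r a - Li_part a r (n * Suc j))))
     + real ((p + q - 2) choose (q - 1)) * (1 / real (n * Suc j)) ^ (p + q - 1) * (a ^ (n * Suc j) * (Li 1 a - Li_part a 1 (n * Suc j)) - Li 1 a))) sums V"
    by (rule double_series_exchange[OF summable_on_gen_harm_terms[OF a n q] rows gen_harm_column_sums[OF a n p q sj]])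
  have Lin: "(\<lambda>j. (a ^ n) ^ Suc j / real (Suc j) ^ t) sums Li t (a ^ n)" if "t \<ge> 2" for t
    using Li_sums[OF sign_power_mem[OF a], of t] that by simp
  have sums_V: "(\<lambda>j. - ((-1) ^ q * real n ^ p) *
      ((\<Sum>l=2..q-1. real ((p + q - l - 1) choose (q - l)) * ((-1) ^ l * Li l a) * (1 / real (Suc j) ^ (p + q - l) / real n ^ (p + q - l)))
     + (\<Sum>r=2..p. real ((p + q - r - 1) choose (p - r)) * ((Li r a * ((a ^ n) ^ Suc j / real (Suc j) ^ (p + q - r))
           - (a ^ n) ^ Suc j * Li_part a r (n * Suc j) / real (Suc j) ^ (p + q - r)) / real n ^ (p + q - r)))
     + real ((p + q - 2) choose (q - 1)) * ((Li 1 a * ((a ^ n) ^ Suc j / real (Suc j) ^ (p + q - 1) - 1 / real (Suc j) ^ (p + q - 1))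
           - (a ^ n) ^ Suc j * Li_part a 1 (n * Suc j) / real (Suc j) ^ (p + q - 1)) / real n ^ (p + q - 1)))) sums ?V"
    by (intro sums_mult sums_add sums_diff sums_sum sums_divide Li_one_sums Lin E) (use p q in auto)
  have summand: "- ((-1) ^ q * real n ^ p) *
      ((\<Sum>l=2..q-1. real ((p + q - l - 1) choose (q - l)) * ((-1) ^ l * Li l a) * (1 / real (Suc j) ^ (p + q - l) / real n ^ (p + q - l)))
     + (\<Sum>r=2..p. real ((p + q - r - 1) choose (p - r)) * ((Li r a * ((a ^ n) ^ Suc j / real (Suc j) ^ (p + q - r))
           - (a ^ n) ^ Suc j * Li_part a r (n * Suc j) / real (Suc j) ^ (p + q - r)) / real n ^ (p + q - r)))
     + real ((p + q - 2) choose (q - 1)) * ((Li 1 a * ((a ^ n) ^ Suc j / real (Suc j) ^ (p + q - 1) - 1 / real (Suc j) ^ (p + q - 1))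
           - (a ^ n) ^ Suc j * Li_part a 1 (n * Suc j) / real (Suc j) ^ (p + q - 1)) / real n ^ (p + q - 1)))
     = - ((-1) ^ q * real n ^ p) *
      ((\<Sum>l=2..q-1. real ((p + q - l - 1) choose (q - l)) * (1 / real (n * Suc j)) ^ (p + q - l) * ((-1) ^ l * Li l a))
     + (\<Sum>r=2..p. real ((p + q - r - 1) choose (p - r)) * (1 / real (n * Suc j)) ^ (p + q - r) * (a ^ (n * Suc j) * (Li r a - Li_part a r (n * Suc j))))
     + real ((p + q - 2) choose (q - 1)) * (1 / real (n * Suc j)) ^ (p + q - 1) * (a ^ (n * Suc j) * (Li 1 a - Li_part a 1 (n * Suc j)) - Li 1 a))" for j
  proof -
    define J where "J = real (Suc j)"
    define e where "e = (a ^ n) ^ Suc j"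
    have J0: "J > 0" "real n > 0" using n by (simp_all add: J_def)
    have M: "(1 / (real n * J)) ^ t = 1 / J ^ t / real n ^ t" for t
      by (simp add: power_divide power_mult_distrib)
    have e': "a ^ (n * Suc j) = e" unfolding e_def by (rule power_mult)
    show ?thesis
      unfolding of_nat_mult J_def[symmetric] e' e_def[symmetric] M
      by (rule arg_cong[where f = "\<lambda>x. - ((-1) ^ q * real n ^ p) * x"],
          intro arg_cong2[where f = "(+)"] sum.cong refl)
        (simp_all add: algebra_simps diff_divide_distrib add_divide_distrib)
  qed
  have "V = ?V" by (rule sums_unique2[OF col sums_V[unfolded summand]])
  with V show ?thesis by simp
qed

text \<open>
  It remains to insert \<open>E r = a * S\<^sub>r\<close>, to collect the powers of \<open>n\<close>, and to join the first-power
  summand, which supplies both \<open>S\<^sub>1\<close> and the term with \<open>Li 1 a\<close>, with the rest of the sum over \<open>r\<close>.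
\<close>

theorem theorem1:
  fixes p q n :: nat and a :: real
  assumes "p \<ge> 1" and "n \<ge> 1" and "q \<ge> 2"
    and "a \<in> {1, -1}"
    and "odd (p + q)"
  shows
    "(\<lambda>k. a ^ Suc k * gen_harm p (real (Suc k) / real n) / real (Suc k) ^ q) sums
      ((-1) ^ q * (\<Sum>r=1..p. a / real n powi (int q - int r)
          * real ((p + q - r - 1) choose (p - r)) * Euler_S p q n a r)
       - (-1) ^ q * (\<Sum>r=2..p. 1 / real n powi (int q - int r)
          * real ((p + q - r - 1) choose (p - r)) * Li r a * Li (p + q - r) (a ^ n))
       - (-1) ^ q * (\<Sum>l=2..q-1. (-1) ^ l / real n ^ (q - l)
          * real ((p + q - l - 1) choose (q - l)) * Li l a * zeta_val (p + q - l))
       + (-1) ^ q / real n ^ (q - 1) * real ((p + q - 2) choose (q - 1))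
          * Li 1 a * (zeta_val (p + q - 1) - Li (p + q - 1) (a ^ n)))
     \<and> (\<forall>r\<in>{1..p}. let s = p + q - r in
         summable (\<lambda>j. (a ^ n) ^ Suc j * twisted_harm a r (n * Suc j) / real (Suc j) ^ s)
       \<and> Euler_S p q n a r =
           a / 2 * (1 + (-1) ^ s) * Li s (a ^ n) * Li r a
         + a / (2 * real n ^ r) * Li (p + q) 1
         - (-1) ^ s * real n ^ s * a * (\<Sum>i=0..s div 2. real ((p + q - 2 * i - 1) choose (r - 1))
             / real n ^ (2 * i) * Li (2 * i) 1 * Li (p + q - 2 * i) a)
         + (-1) ^ r * a / real n ^ r * (\<Sum>i=0..r div 2. real ((p + q - 2 * i - 1) choose (s - 1))
             * Li (2 * i) 1 * Li (p + q - 2 * i) (a ^ n))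
         + (-1) ^ r * a ^ (n + 1) / (2 * real n ^ r)
             * (\<Sum>i=1..n-1. \<Sum>k=1..r. real ((p + q - k - 1) choose (s - 1))
                 * a ^ i * (-1) ^ k * Theta_one k i n
                 * Lerch_Phi (a ^ n) (p + q - k) (real (n - i) / real n)))"
proof -
  note p = assms(1) and n = assms(2) and q = assms(3) and a = assms(4) and odd = assms(5)
  have aa: "a * a = 1" using a by auto
  define F where "F r = (let s = p + q - r in
           a / 2 * (1 + (-1) ^ s) * Li s (a ^ n) * Li r a
         + a / (2 * real n ^ r) * Li (p + q) 1
         - (-1) ^ s * real n ^ s * a * (\<Sum>i=0..s div 2. real ((p + q - 2 * i - 1) choose (r - 1))
             / real n ^ (2 * i) * Li (2 * i) 1 * Li (p + q - 2 * i) a)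
         + (-1) ^ r * a / real n ^ r * (\<Sum>i=0..r div 2. real ((p + q - 2 * i - 1) choose (s - 1))
             * Li (2 * i) 1 * Li (p + q - 2 * i) (a ^ n))
         + (-1) ^ r * a ^ (n + 1) / (2 * real n ^ r)
             * (\<Sum>i=1..n-1. \<Sum>k=1..r. real ((p + q - k - 1) choose (s - 1))
                 * a ^ i * (-1) ^ k * Theta_one k i n
                 * Lerch_Phi (a ^ n) (p + q - k) (real (n - i) / real n)))" for r
  have E: "(\<lambda>j. (a ^ n) ^ Suc j * Li_part a r (n * Suc j) / real (Suc j) ^ (p + q - r)) sums (a * F r)"
    if r: "r \<in> {1..p}" for r
  proof -
    have rs: "r + (p + q - r) = p + q" "r \<ge> 1" "p + q - r \<ge> 2" using r q by auto
    show ?thesis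
      using Euler_sum_odd_weight_closed_form[OF a n rs(2,3)] odd
      unfolding F_def Let_def Lerch_part_def rs by simp
  qed
  have S: "(\<lambda>j. (a ^ n) ^ Suc j * twisted_harm a r (n * Suc j) / real (Suc j) ^ (p + q - r)) sums F r"
    if r: "r \<in> {1..p}" for r
  proof -
    have "(\<lambda>j. a * ((a ^ n) ^ Suc j * Li_part a r (n * Suc j) / real (Suc j) ^ (p + q - r))) sums (a * (a * F r))"
      by (intro sums_mult E r)
    moreover have "a * ((a ^ n) ^ Suc j * Li_part a r (n * Suc j) / real (Suc j) ^ (p + q - r))
       = (a ^ n) ^ Suc j * twisted_harm a r (n * Suc j) / real (Suc j) ^ (p + q - r)" for j
    proof -
      have "a * (x * (a * y) / z) = (a * a) * (x * y / z)" for x y z by simp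
      then show ?thesis unfolding Li_part_eq_twisted_harm[OF a] aa mult_1 .
    qed
    moreover have "a * (a * F r) = F r" by (simp only: mult.assoc[symmetric] aa mult_1)
    ultimately show ?thesis by (simp only:)
  qed
  have ES: "Euler_S p q n a r = F r" if "r \<in> {1..p}" for r
    using S[OF that] by (simp add: Euler_S_def sums_iff)
  have pow: "real n ^ p / real n ^ (p + q - r) = 1 / real n powi (int q - int r)" if "r \<le> p" for r
  proof -
    have "real n powi (int q - int r) = real n ^ q / real n ^ r"
      using n by (simp add: power_int_diff)
    moreover have "real n ^ (p + q - r) * real n ^ r = real n ^ p * real n ^ q"
      using that by (simp flip: power_add)
    ultimately show ?thesis using n by (simp add: frac_eq_eq mult.commute)
  qed
  have pow': "real n ^ p / real n ^ (p + q - l) = 1 / real n ^ (q - l)" if "l \<le> q" for l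
  proof -
    have "real n ^ (p + q - l) = real n ^ p * real n ^ (q - l)" using that by (simp flip: power_add)
    then show ?thesis using n by simp
  qed
  have zv: "zeta_val (p + q - l) = Li (p + q - l) 1" if "l \<le> q - 1" for l
    using that p q by (intro zeta_val_eq_Li) auto
  define A where "A = (\<Sum>l=2..q-1. real ((p + q - l - 1) choose (q - l)) * ((-1) ^ l * Li l a) * (Li (p + q - l) 1 / real n ^ (p + q - l)))"
  define B where "B = (\<Sum>r=2..p. real ((p + q - r - 1) choose (p - r)) * ((Li r a * Li (p + q - r) (a ^ n) - a * F r) / real n ^ (p + q - r)))"
  define C where "C = real ((p + q - 2) choose (q - 1)) * ((Li 1 a * (Li (p + q - 1) (a ^ n) - Li (p + q - 1) 1) - a * F 1) / real n ^ (p + q - 1))"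
  have A: "real n ^ p * A = (\<Sum>l=2..q-1. (-1) ^ l / real n ^ (q - l)
          * real ((p + q - l - 1) choose (q - l)) * Li l a * zeta_val (p + q - l))"
    unfolding A_def sum_distrib_left
  proof (intro sum.cong refl)
    fix l assume l: "l \<in> {2..q-1}"
    have "real n ^ p * (real ((p + q - l - 1) choose (q - l)) * ((-1) ^ l * Li l a) * (Li (p + q - l) 1 / real n ^ (p + q - l)))
      = (real n ^ p / real n ^ (p + q - l)) * (real ((p + q - l - 1) choose (q - l)) * ((-1) ^ l * Li l a) * Li (p + q - l) 1)"
      by simp
    also have "\<dots> = (-1) ^ l / real n ^ (q - l)
          * real ((p + q - l - 1) choose (q - l)) * Li l a * zeta_val (p + q - l)"
      using l by (subst pow') (auto simp: zv)
    finally show "real n ^ p * (real ((p + q - l - 1) choose (q - l)) * ((-1) ^ l * Li l a) * (Li (p + q - l) 1 / real n ^ (p + q - l))) = \<dots>" .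
  qed
  have B: "real n ^ p * B = (\<Sum>r=2..p. 1 / real n powi (int q - int r)
          * real ((p + q - r - 1) choose (p - r)) * Li r a * Li (p + q - r) (a ^ n))
       - (\<Sum>r=2..p. a / real n powi (int q - int r) * real ((p + q - r - 1) choose (p - r)) * Euler_S p q n a r)"
    unfolding B_def sum_distrib_left sum_subtractf[symmetric]
  proof (intro sum.cong refl)
    fix r assume r: "r \<in> {2..p}"
    have "real n ^ p * (real ((p + q - r - 1) choose (p - r)) * ((Li r a * Li (p + q - r) (a ^ n) - a * F r) / real n ^ (p + q - r)))
      = (real n ^ p / real n ^ (p + q - r)) * (real ((p + q - r - 1) choose (p - r)) * (Li r a * Li (p + q - r) (a ^ n) - a * F r))"
      by simp
    also have "\<dots> = 1 / real n powi (int q - int r) * real ((p + q - r - 1) choose (p - r)) * Li r a * Li (p + q - r) (a ^ n)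
       - a / real n powi (int q - int r) * real ((p + q - r - 1) choose (p - r)) * Euler_S p q n a r"
      using r by (subst pow) (auto simp: ES right_diff_distrib diff_divide_distrib mult_ac)
    finally show "real n ^ p * (real ((p + q - r - 1) choose (p - r)) * ((Li r a * Li (p + q - r) (a ^ n) - a * F r) / real n ^ (p + q - r))) = \<dots>" .
  qed
  have bin: "(p + q - 2) choose (q - 1) = (p + q - 1 - 1) choose (p - 1)"
  proof -
    have "p - 1 \<le> p + q - 2" "p + q - 2 - (p - 1) = q - 1" "p + q - 1 - 1 = p + q - 2" using p q by auto
    then show ?thesis using binomial_symmetric[of "p - 1" "p + q - 2"] by simp
  qed
  have "real n ^ p * C = (real n ^ p / real n ^ (p + q - 1)) * (real ((p + q - 2) choose (q - 1)) * (Li 1 a * (Li (p + q - 1) (a ^ n) - Li (p + q - 1) 1)))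
      - (real n ^ p / real n ^ (p + q - 1)) * (real ((p + q - 2) choose (q - 1)) * (a * F 1))"
    unfolding C_def by (simp add: right_diff_distrib diff_divide_distrib)
  also have "(real n ^ p / real n ^ (p + q - 1)) * (real ((p + q - 2) choose (q - 1)) * (Li 1 a * (Li (p + q - 1) (a ^ n) - Li (p + q - 1) 1)))
      = - (1 / real n ^ (q - 1) * real ((p + q - 2) choose (q - 1)) * Li 1 a * (zeta_val (p + q - 1) - Li (p + q - 1) (a ^ n)))"
    using q zv[of 1] by (subst pow') (auto simp: algebra_simps diff_divide_distrib)
  also have "(real n ^ p / real n ^ (p + q - 1)) * (real ((p + q - 2) choose (q - 1)) * (a * F 1))
      = a / real n powi (int q - int 1) * real ((p + q - 1 - 1) choose (p - 1)) * Euler_S p q n a 1"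
    unfolding bin[symmetric] using p ES[of 1] by (subst pow) auto
  finally have C: "real n ^ p * C = - (1 / real n ^ (q - 1) * real ((p + q - 2) choose (q - 1)) * Li 1 a * (zeta_val (p + q - 1) - Li (p + q - 1) (a ^ n)))
      - a / real n powi (int q - int 1) * real ((p + q - 1 - 1) choose (p - 1)) * Euler_S p q n a 1" .
  have first: "(\<Sum>r=1..p. g r) = g 1 + (\<Sum>r=2..p. g r)" for g :: "nat \<Rightarrow> real"
  proof -
    have "{1..p} = insert 1 {2..p}" using p by auto
    then show ?thesis by simp
  qed
  have "- ((-1) ^ q * real n ^ p) * (A + B + C) = - ((-1) ^ q) * (real n ^ p * A + real n ^ p * B + real n ^ p * C)"
    by (simp add: algebra_simps)
  also have "\<dots> = (-1) ^ q * (\<Sum>r=1..p. a / real n powi (int q - int r)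
          * real ((p + q - r - 1) choose (p - r)) * Euler_S p q n a r)
       - (-1) ^ q * (\<Sum>r=2..p. 1 / real n powi (int q - int r)
          * real ((p + q - r - 1) choose (p - r)) * Li r a * Li (p + q - r) (a ^ n))
       - (-1) ^ q * (\<Sum>l=2..q-1. (-1) ^ l / real n ^ (q - l)
          * real ((p + q - l - 1) choose (q - l)) * Li l a * zeta_val (p + q - l))
       + (-1) ^ q / real n ^ (q - 1) * real ((p + q - 2) choose (q - 1))
          * Li 1 a * (zeta_val (p + q - 1) - Li (p + q - 1) (a ^ n))"
    unfolding A B C first by (simp add: distrib_left right_diff_distrib)
  finally have "(\<lambda>k. a ^ Suc k * gen_harm p (real (Suc k) / real n) / real (Suc k) ^ q) sums \<dots>"
    using gen_harm_series[OF a n p q E, folded A_def B_def C_def] by (simp only:)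
  moreover have "\<forall>r\<in>{1..p}. let s = p + q - r in
         summable (\<lambda>j. (a ^ n) ^ Suc j * twisted_harm a r (n * Suc j) / real (Suc j) ^ s)
       \<and> Euler_S p q n a r = F r"
    using S ES by (auto simp: Let_def sums_iff)
  ultimately show ?thesis unfolding F_def Let_def by blast
qed

end
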